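(* (i) $\mathfrak{M}_{>0}$ is the free Zinbiel algebra on the two elements $xx$ and $W_1$. (ii) The elements $(xx)^{\sqcup\!\sqcup\, m}\sqcup\!\sqcup\, W_{p_1,\dots,p_r}$ with $m,r\geq 0$ and odd $p_1,\dots,p_r\geq 1$ form a $\mathbb{Q}$-basis of $\mathfrak{M}$. (iii) The $\mathbb{Q}$-linear map $$\mathbb{Q}[f_2]\otimes\mathbb{Q}\langle f_3,f_5,f_7,\dots\rangle_{\sqcup\!\sqcup}\longrightarrow\mathfrak{M},\qquad f_2^m\otimes f_{k_1}\cdots f_{k_r}\longmapsto (xx)^{\sqcup\!\sqcup\, m}\sqcup\!\sqcup\, W_{k_1-2,\dots,k_r-2}$$ is an isomorphism of $\mathbb{Q}$-algebras, where $\mathfrak{M}$ carries the shuffle product.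
   Context: Let $\mathfrak{H}=\mathbb{Q}\langle x,y\rangle$ be the $\mathbb{Q}$-vector space with basis the words in the letters $x,y$ (including the empty word $1$), equipped with the commutative shuffle product $\sqcup\!\sqcup$; let $\mathfrak{H}_{>0}$ be the span of the nonempty words. Juxtaposition denotes concatenation, and $u^{\sqcup\!\sqcup\, m}$ denotes the $m$-fold shuffle power ($u^{\sqcup\!\sqcup\, 0}=1$). For $p\geq 1$ set $q_p=x^{\sqcup\!\sqcup\, p}\sqcup\!\sqcup\, y=p!\sum_{a+b=p,\ a,b\geq 0}x^a y x^b$. Define recursively $W_\varnothing=1$ and $$W_{p_1,\dots,p_r}=x\bigl(q_{p_1}\sqcup\!\sqcup\, W_{p_2,\dots,p_r}\bigr)\qquad(p_1,\dots,p_r\geq 1),$$ where the multiplication by $x$ on the left is concatenation. In particular $W_1=xxy+xyx$. For $r=0$, $W_{p_1,\dots,p_r}$ means $W_\varnothing=1$. A Zinbiel algebra is a $\mathbb{Q}$-vector space with a bilinear product $\prec$ satisfying $(u\prec v)\prec w=u\prec(v\prec w)+u\prec(w\prec v)$ for all $u,v,w$. On $\mathfrak{H}_{>0}$ a Zinbiel product is defined by $(au)\prec v=a(u\sqcup\!\sqcup\, v)$ for a letter $a\in\{x,y\}$ and words $u,v$ (with $v$ nonempty, $u$ possibly empty), extended bilinearly; its symmetrization $u\prec v+v\prec u$ is the shuffle product. Let $\mathfrak{M}_{>0}$ be the Zinbiel subalgebra of $(\mathfrak{H}_{>0},\prec)$ generated by $xx$ and $W_1$, and set $\mathfrak{M}=\mathbb{Q}\cdot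 1\oplus\mathfrak{M}_{>0}$, which is a subalgebra of $(\mathfrak{H},\sqcup\!\sqcup)$. $\mathbb{Q}\langle f_3,f_5,f_7,\dots\rangle_{\sqcup\!\sqcup}$ is the $\mathbb{Q}$-vector space with basis the words (including the empty word) in letters $f_k$, one for each odd $k\geq 3$, with the shuffle product; $\mathbb{Q}[f_2]$ is the polynomial ring in one variable. In (iii), $m,r\geq 0$ and $k_1,\dots,k_r\geq 3$ are odd. *)

theory Defs
  imports
    "HOL-Library.Poly_Mapping"
    "HOL-Library.FuncSet"
    "HOL-Computational_Algebra.Polynomial"
begin

section \<open>Free rational vector spaces\<close>

text \<open>
  The rational vector space with basis \<open>'b\<close> is the type \<^typ>\<open>'b \<Rightarrow>\<^sub>0 rat\<close> of finitely
  supported functions.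
\<close>

definition qscale :: "rat \<Rightarrow> ('b \<Rightarrow>\<^sub>0 rat) \<Rightarrow> ('b \<Rightarrow>\<^sub>0 rat)"
  where "qscale c u = Poly_Mapping.map (\<lambda>x. c * x) u"

lemma lookup_qscale [simp]:
  "Poly_Mapping.lookup (qscale c u) w = c * Poly_Mapping.lookup u w"
  by (simp add: qscale_def Poly_Mapping.map.rep_eq when_def)

global_interpretation qv: vector_space "qscale :: rat \<Rightarrow> ('b \<Rightarrow>\<^sub>0 rat) \<Rightarrow> ('b \<Rightarrow>\<^sub>0 rat)"
  by standard (auto intro!: poly_mapping_eqI simp: lookup_add algebra_simps)

abbreviation basis_vec :: "'b \<Rightarrow> ('b \<Rightarrow>\<^sub>0 rat)"
  where "basis_vec w \<equiv> Poly_Mapping.single w 1"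

definition lin_ext :: "('b \<Rightarrow> ('c \<Rightarrow>\<^sub>0 rat)) \<Rightarrow> ('b \<Rightarrow>\<^sub>0 rat) \<Rightarrow> ('c \<Rightarrow>\<^sub>0 rat)"
  where "lin_ext f u = (\<Sum>w\<in>Poly_Mapping.keys u. qscale (Poly_Mapping.lookup u w) (f w))"

definition is_basis_family ::
    "(rat \<Rightarrow> 'v \<Rightarrow> 'v) \<Rightarrow> 'i set \<Rightarrow> ('i \<Rightarrow> 'v::ab_group_add) \<Rightarrow> 'v set \<Rightarrow> bool"
  where "is_basis_family scale I b V \<longleftrightarrow>
    inj_on b I \<and> \<not> module.dependent scale (b ` I) \<and> module.span scale (b ` I) = V"


section \<open>The shuffle product\<close>

definition prepend :: "'a \<Rightarrow> ('a list \<Rightarrow>\<^sub>0 rat) \<Rightarrow> ('a list \<Rightarrow>\<^sub>0 rat)"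
  where "prepend a = lin_ext (\<lambda>w. basis_vec (a # w))"

text \<open>
  The library function \<^const>\<open>shuffles\<close> returns a set of words and hence forgets
  multiplicities; here they are kept.
\<close>

fun shuffle_words :: "'a list \<Rightarrow> 'a list \<Rightarrow> ('a list \<Rightarrow>\<^sub>0 rat)"
  where
    "shuffle_words [] v = basis_vec v"
  | "shuffle_words u [] = basis_vec u"
  | "shuffle_words (a # u) (b # v) =
       prepend a (shuffle_words u (b # v)) + prepend b (shuffle_words (a # u) v)"

definition shuffle_prod ::
    "('a list \<Rightarrow>\<^sub>0 rat) \<Rightarrow> ('a list \<Rightarrow>\<^sub>0 rat) \<Rightarrow> ('a list \<Rightarrow>\<^sub>0 rat)"  (infixl \<open>\<squnion>\<squnion>\<close> 70)
  where "u \<squnion>\<squnion> v = lin_ext (\<lambda>a. lin_ext (\<lambda>b. shuffle_words a b) v) u"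

fun shuffle_pow :: "('a list \<Rightarrow>\<^sub>0 rat) \<Rightarrow> nat \<Rightarrow> ('a list \<Rightarrow>\<^sub>0 rat)"
  where
    "shuffle_pow u 0 = basis_vec []"
  | "shuffle_pow u (Suc m) = u \<squnion>\<squnion> shuffle_pow u m"


section \<open>Zinbiel algebras\<close>

text \<open>A Zinbiel algebra is a subspace \<open>A\<close> of an ambient rational vector space with a product on \<open>A\<close>.\<close>

locale zinbiel_algebra = vector_space scale
  for scale :: "rat \<Rightarrow> 'v::ab_group_add \<Rightarrow> 'v" +
  fixes A :: "'v set" and prec :: "'v \<Rightarrow> 'v \<Rightarrow> 'v"
  assumes subspace_carrier: "module.subspace scale A"
    and prec_closed: "\<And>u v. u \<in> A \<Longrightarrow> v \<in> A \<Longrightarrow> prec u v \<in> A"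
    and prec_add_left: "\<And>u u' v. u \<in> A \<Longrightarrow> u' \<in> A \<Longrightarrow> v \<in> A \<Longrightarrow>
          prec (u + u') v = prec u v + prec u' v"
    and prec_add_right: "\<And>u v v'. u \<in> A \<Longrightarrow> v \<in> A \<Longrightarrow> v' \<in> A \<Longrightarrow>
          prec u (v + v') = prec u v + prec u v'"
    and prec_scale_left: "\<And>c u v. u \<in> A \<Longrightarrow> v \<in> A \<Longrightarrow> prec (scale c u) v = scale c (prec u v)"
    and prec_scale_right: "\<And>c u v. u \<in> A \<Longrightarrow> v \<in> A \<Longrightarrow> prec u (scale c v) = scale c (prec u v)"
    and zinbiel: "\<And>u v w. u \<in> A \<Longrightarrow> v \<in> A \<Longrightarrow> w \<in> A \<Longrightarrow>
          prec (prec u v) w = prec u (prec v w) + prec u (prec w v)"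

definition zinbiel_hom_on ::
    "(rat \<Rightarrow> 'v::ab_group_add \<Rightarrow> 'v) \<Rightarrow> 'v set \<Rightarrow> ('v \<Rightarrow> 'v \<Rightarrow> 'v) \<Rightarrow>
     (rat \<Rightarrow> 'z::ab_group_add \<Rightarrow> 'z) \<Rightarrow> 'z set \<Rightarrow> ('z \<Rightarrow> 'z \<Rightarrow> 'z) \<Rightarrow> ('v \<Rightarrow> 'z) \<Rightarrow> bool"
  where "zinbiel_hom_on scale A prec scale' Z prec' \<phi> \<longleftrightarrow>
    \<phi> \<in> A \<rightarrow> Z \<and>
    (\<forall>u\<in>A. \<forall>v\<in>A. \<phi> (u + v) = \<phi> u + \<phi> v) \<and>
    (\<forall>c. \<forall>u\<in>A. \<phi> (scale c u) = scale' c (\<phi> u)) \<and>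
    (\<forall>u\<in>A. \<forall>v\<in>A. \<phi> (prec u v) = prec' (\<phi> u) (\<phi> v))"

text \<open>
  Universal property of the free Zinbiel algebra on the set \<open>G\<close>, for target algebras whose
  elements have type \<open>'z\<close>.  A definition cannot quantify over types, so \<open>'z\<close> is a parameter;
  freeness is the statement for arbitrary \<open>'z\<close>.  Homomorphisms are taken in
  \<^term>\<open>extensional A\<close>, so that uniqueness means uniqueness on \<open>A\<close>.
\<close>

definition free_zinbiel_algebra ::
    "'z::ab_group_add itself \<Rightarrow> (rat \<Rightarrow> 'v::ab_group_add \<Rightarrow> 'v) \<Rightarrow> 'v set \<Rightarrow> ('v \<Rightarrow> 'v \<Rightarrow> 'v) \<Rightarrow>
     'v set \<Rightarrow> bool"
  where "free_zinbiel_algebra T scale A prec G \<longleftrightarrow>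
    zinbiel_algebra scale A prec \<and> G \<subseteq> A \<and>
    (\<forall>(scale' :: rat \<Rightarrow> 'z \<Rightarrow> 'z) Z prec' h.
       zinbiel_algebra scale' Z prec' \<and> h \<in> G \<rightarrow> Z \<longrightarrow>
       (\<exists>!\<phi>. \<phi> \<in> extensional A \<and> zinbiel_hom_on scale A prec scale' Z prec' \<phi> \<and>
             (\<forall>g\<in>G. \<phi> g = h g)))"

definition zinbiel_generated ::
    "(rat \<Rightarrow> 'v::ab_group_add \<Rightarrow> 'v) \<Rightarrow> 'v set \<Rightarrow> ('v \<Rightarrow> 'v \<Rightarrow> 'v) \<Rightarrow> 'v set \<Rightarrow> 'v set"
  where "zinbiel_generated scale A prec G =
    \<Inter>{S. module.subspace scale S \<and> S \<subseteq> A \<and> (\<forall>u\<in>S. \<forall>v\<in>S. prec u v \<in> S) \<and> G \<subseteq> S}"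

text \<open>
  The half-shuffle of nonempty words.  On the left factor \<open>[]\<close> it is set to \<open>0\<close>; it is only
  used on the span of the nonempty words.
\<close>

fun half_shuffle_words :: "'a list \<Rightarrow> 'a list \<Rightarrow> ('a list \<Rightarrow>\<^sub>0 rat)"
  where
    "half_shuffle_words [] v = 0"
  | "half_shuffle_words (a # u) v = prepend a (shuffle_words u v)"

definition half_shuffle ::
    "('a list \<Rightarrow>\<^sub>0 rat) \<Rightarrow> ('a list \<Rightarrow>\<^sub>0 rat) \<Rightarrow> ('a list \<Rightarrow>\<^sub>0 rat)"  (infixl \<open>\<prec>\<close> 70)
  where "u \<prec> v = lin_ext (\<lambda>a. lin_ext (\<lambda>b. half_shuffle_words a b) v) u"


section \<open>The algebra generated by \<open>xx\<close> and \<open>W\<^sub>1\<close>\<close>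

datatype letter = Lx | Ly

type_synonym hoffman = "letter list \<Rightarrow>\<^sub>0 rat"

definition H_pos :: "hoffman set"
  where "H_pos = qv.span (basis_vec ` {w. w \<noteq> []})"

definition q_elem :: "nat \<Rightarrow> hoffman"
  where "q_elem p = shuffle_pow (basis_vec [Lx]) p \<squnion>\<squnion> basis_vec [Ly]"

fun W_elem :: "nat list \<Rightarrow> hoffman"
  where
    "W_elem [] = basis_vec []"
  | "W_elem (p # ps) = prepend Lx (q_elem p \<squnion>\<squnion> W_elem ps)"

definition xx_elem :: hoffman
  where "xx_elem = basis_vec [Lx, Lx]"

definition M_pos :: "hoffman set"
  where "M_pos = zinbiel_generated qscale H_pos (\<prec>) {xx_elem, W_elem [1]}"

definition M_alg :: "hoffman set"
  where "M_alg = {qscale c (basis_vec []) + u | c u. u \<in> M_pos}"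


section \<open>The tensor product of \<open>\<rat>[f\<^sub>2]\<close> with a shuffle algebra\<close>

text \<open>
  \<open>\<rat>[f\<^sub>2]\<close> is \<^typ>\<open>rat poly\<close>.  Its tensor product with the shuffle algebra on the letters
  \<open>'k\<close> is realised on the basis of all pairs \<open>(m, w)\<close>, standing for \<open>f\<^sub>2\<^sup>m \<otimes> w\<close>; the lemmas
  \<open>tensor_universal\<close> and \<open>tensor_mult_pure\<close> below show that this is the tensor product of
  algebras.
\<close>

type_synonym 'k tensor = "nat \<times> 'k list \<Rightarrow>\<^sub>0 rat"

definition pure_tensor :: "rat poly \<Rightarrow> ('k list \<Rightarrow>\<^sub>0 rat) \<Rightarrow> 'k tensor"  (infixl \<open>\<otimes>\<close> 70)
  where "p \<otimes> u = (\<Sum>m\<le>degree p. qscale (coeff p m) (lin_ext (\<lambda>w. basis_vec (m, w)) u))"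

definition tensor_one :: "'k tensor"
  where "tensor_one = 1 \<otimes> basis_vec []"

definition tensor_mult :: "'k tensor \<Rightarrow> 'k tensor \<Rightarrow> 'k tensor"
  where "tensor_mult s t =
    lin_ext (\<lambda>(m, u). lin_ext (\<lambda>(n, v). monom 1 (m + n) \<otimes> shuffle_words u v) t) s"

lemma keys_expansion:
  "u = (\<Sum>w\<in>Poly_Mapping.keys u. qscale (Poly_Mapping.lookup u w) (basis_vec w))"
proof (rule poly_mapping_eqI)
  fix k
  show "Poly_Mapping.lookup u k = Poly_Mapping.lookup
      (\<Sum>w\<in>Poly_Mapping.keys u. qscale (Poly_Mapping.lookup u w) (basis_vec w)) k"
    by (simp add: lookup_sum lookup_single when_def sum.delta if_distrib in_keys_iff cong: if_cong)
qed

lemma qv_induct [case_names zero basis add scale]: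
  assumes "P 0" "\<And>w. P (basis_vec w)" "\<And>u v. P u \<Longrightarrow> P v \<Longrightarrow> P (u + v)"
    "\<And>c u. P u \<Longrightarrow> P (qscale c u)"
  shows "P u"
proof -
  have "P (\<Sum>w\<in>K. qscale (f w) (basis_vec w))" if "finite K" for K f
    using that by (induction K rule: finite_induct) (auto intro: assms)
  from this[of "Poly_Mapping.keys u" "Poly_Mapping.lookup u"] show ?thesis
    using keys_expansion[of u] by simp
qed

lemma poly_lin_induct [case_names zero basis add scale]:
  fixes p :: "rat poly"
  assumes "P 0" "\<And>m. P (monom 1 m)" "\<And>u v. P u \<Longrightarrow> P v \<Longrightarrow> P (u + v)"
    "\<And>c u. P u \<Longrightarrow> P (smult c u)"
  shows "P p"
proof -
  have "P (\<Sum>i\<in>K. monom (f i) i)" if "finite K" for K f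
    using that
  proof (induction K rule: finite_induct)
    case (insert i K)
    have "P (monom (f i) i)"
      using assms(4)[OF assms(2), of "f i" i] by (simp add: smult_monom)
    with insert show ?case by (auto intro: assms)
  qed (auto intro: assms)
  from this[of "{..degree p}" "coeff p"] show ?thesis
    by (simp add: poly_as_sum_of_monoms)
qed

lemma (in vector_space) sum_keys_mono:
  fixes f :: "'c \<Rightarrow> 'b" and u :: "'c \<Rightarrow>\<^sub>0 'a"
  assumes "finite K" "Poly_Mapping.keys u \<subseteq> K"
  shows "(\<Sum>w\<in>Poly_Mapping.keys u. scale (Poly_Mapping.lookup u w) (f w)) =
    (\<Sum>w\<in>K. scale (Poly_Mapping.lookup u w) (f w))"
  by (rule sum.mono_neutral_left) (use assms in \<open>auto simp: in_keys_iff\<close>)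

lemma linear_extend:
  fixes scale :: "rat \<Rightarrow> 'v::ab_group_add \<Rightarrow> 'v" and f :: "'b \<Rightarrow> 'v"
  assumes "vector_space scale"
  defines "L \<equiv> \<lambda>u. \<Sum>w\<in>Poly_Mapping.keys u. scale (Poly_Mapping.lookup u w) (f w)"
  shows "Vector_Spaces.linear qscale scale L" "L (basis_vec w) = f w"
proof -
  interpret V: vector_space scale by fact
  show "Vector_Spaces.linear qscale scale L"
  proof (unfold_locales, goal_cases)
    case (1 u v)
    let ?K = "Poly_Mapping.keys u \<union> Poly_Mapping.keys v"
    have "L (u + v) = (\<Sum>w\<in>?K. scale (Poly_Mapping.lookup (u + v) w) (f w))"
      unfolding L_def by (rule V.sum_keys_mono) (use Poly_Mapping.keys_add[of u v] in auto)
    moreover have "L u = (\<Sum>w\<in>?K. scale (Poly_Mapping.lookup u w) (f w))"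
      unfolding L_def by (rule V.sum_keys_mono) auto
    moreover have "L v = (\<Sum>w\<in>?K. scale (Poly_Mapping.lookup v w) (f w))"
      unfolding L_def by (rule V.sum_keys_mono) auto
    ultimately show ?case
      by (simp add: lookup_add V.scale_left_distrib sum.distrib)
  next
    case (2 c u)
    have "L (qscale c u) =
        (\<Sum>w\<in>Poly_Mapping.keys u. scale (Poly_Mapping.lookup (qscale c u) w) (f w))"
      unfolding L_def by (rule V.sum_keys_mono) (auto simp: in_keys_iff)
    then show ?case
      by (simp add: L_def V.scale_sum_right)
  qed
  show "L (basis_vec w) = f w"
    by (simp add: L_def)
qed

lemma
  linear_lin_ext: "Vector_Spaces.linear qscale qscale (lin_ext f)" and
  lin_ext_basis [simp]: "lin_ext f (basis_vec w) = f w"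
  using linear_extend[OF qv.vector_space_axioms, of f] by (simp_all add: lin_ext_def[abs_def])

lemma
  lin_ext_add [simp]: "lin_ext f (u + v) = lin_ext f u + lin_ext f v" and
  lin_ext_scale [simp]: "lin_ext f (qscale c u) = qscale c (lin_ext f u)" and
  lin_ext_zero [simp]: "lin_ext f 0 = 0"
proof -
  interpret Vector_Spaces.linear qscale qscale "lin_ext f" by (rule linear_lin_ext)
  show "lin_ext f (u + v) = lin_ext f u + lin_ext f v"
    "lin_ext f (qscale c u) = qscale c (lin_ext f u)" "lin_ext f 0 = 0"
    by (rule add scale zero)+
qed

lemma lin_ext_fun_add: "lin_ext (\<lambda>w. f w + g w) u = lin_ext f u + lin_ext g u"
  by (induction u rule: qv_induct) (simp_all add: algebra_simps qv.scale_right_distrib)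

lemma lin_ext_fun_scale: "lin_ext (\<lambda>w. qscale c (f w)) u = qscale c (lin_ext f u)"
  by (induction u rule: qv_induct)
     (simp_all add: qv.scale_right_distrib mult.commute)

lemma lookup_pure_tensor:
  "Poly_Mapping.lookup (p \<otimes> u) (m, w) = coeff p m * Poly_Mapping.lookup u w"
proof -
  have "Poly_Mapping.lookup (lin_ext (\<lambda>w. basis_vec (n, w)) u) (m, w) =
      (if n = m then Poly_Mapping.lookup u w else 0)" for n
    by (induction u rule: qv_induct) (auto simp: lookup_single when_def lookup_add)
  then show ?thesis
    by (simp only: pure_tensor_def lookup_sum lookup_qscale)
       (auto simp: if_distrib coeff_eq_0 cong: if_cong)
qed

lemma pure_tensor_monom: "monom 1 m \<otimes> basis_vec w = basis_vec (m, w)"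
proof (rule poly_mapping_eqI)
  fix k show "Poly_Mapping.lookup (monom 1 m \<otimes> basis_vec w) k =
      Poly_Mapping.lookup (basis_vec (m, w)) k"
    by (cases k) (auto simp: lookup_pure_tensor lookup_single when_def)
qed

lemma
  pure_tensor_add_left: "(p + q) \<otimes> u = p \<otimes> u + q \<otimes> u" and
  pure_tensor_add_right: "p \<otimes> (u + v) = p \<otimes> u + p \<otimes> v" and
  pure_tensor_scale_left: "smult c p \<otimes> u = qscale c (p \<otimes> u)" and
  pure_tensor_scale_right: "p \<otimes> qscale c u = qscale c (p \<otimes> u)" and
  pure_tensor_zero_left: "0 \<otimes> u = 0" and
  pure_tensor_zero_right: "p \<otimes> 0 = 0"
  by (auto intro!: poly_mapping_eqI simp: lookup_pure_tensor lookup_add algebra_simps)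

lemmas pure_tensor_bilinear = pure_tensor_add_left pure_tensor_add_right
  pure_tensor_scale_left pure_tensor_scale_right pure_tensor_zero_left pure_tensor_zero_right

lemma tensor_universal:
  fixes scale :: "rat \<Rightarrow> 'v::ab_group_add \<Rightarrow> 'v" and B :: "rat poly \<Rightarrow> ('k list \<Rightarrow>\<^sub>0 rat) \<Rightarrow> 'v"
  assumes "vector_space scale"
    and B_left: "\<And>u. Vector_Spaces.linear smult scale (\<lambda>p. B p u)"
    and B_right: "\<And>p. Vector_Spaces.linear qscale scale (B p)"
  shows "\<exists>!L. Vector_Spaces.linear qscale scale L \<and> (\<forall>p u. L (p \<otimes> u) = B p u)"
proof -
  interpret V: vector_space scale by fact
  have Bl: "B (p + q) u = B p u + B q u" "B (smult c p) u = scale c (B p u)" "B 0 u = 0" for p q c u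
    using Vector_Spaces.linear.axioms(3)[OF B_left] 
    by (blast dest: module_hom.add module_hom.scale module_hom.zero)+
  have Br: "B p (u + v) = B p u + B p v" "B p (qscale c u) = scale c (B p u)" "B p 0 = 0" for p u v c
    using Vector_Spaces.linear.axioms(3)[OF B_right] 
    by (blast dest: module_hom.add module_hom.scale module_hom.zero)+
  have ext: "L (p \<otimes> u) = B p u"
    if "Vector_Spaces.linear qscale scale L" "\<And>m w. L (basis_vec (m, w)) = B (monom 1 m) (basis_vec w)"
    for L p u
  proof -
    interpret L: Vector_Spaces.linear qscale scale L by fact
    have *: "L (monom 1 m \<otimes> u) = B (monom 1 m) u" for m
      by (induction u rule: qv_induct)
         (simp_all add: pure_tensor_monom pure_tensor_bilinear that(2) Br L.zero L.add L.scale)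
    show ?thesis
      by (induction p rule: poly_lin_induct)
         (simp_all add: * pure_tensor_bilinear Bl L.zero L.add L.scale)
  qed
  define L where "L = (\<lambda>t. \<Sum>w\<in>Poly_Mapping.keys t. scale (Poly_Mapping.lookup t w)
      (case w of (m, w) \<Rightarrow> B (monom 1 m) (basis_vec w)))"
  have L: "Vector_Spaces.linear qscale scale L" 
    "L (basis_vec (m, w)) = B (monom 1 m) (basis_vec w)" for m w
    unfolding L_def by (rule linear_extend[OF assms(1)], simp add: linear_extend[OF assms(1)])
  show ?thesis
  proof (rule ex1I[of _ L])
    show "Vector_Spaces.linear qscale scale L \<and> (\<forall>p u. L (p \<otimes> u) = B p u)"
      using ext L by blast
  next
    fix L' assume L': "Vector_Spaces.linear qscale scale L' \<and> (\<forall>p u. L' (p \<otimes> u) = B p u)"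
    interpret L: Vector_Spaces.linear qscale scale L by fact
    interpret L': Vector_Spaces.linear qscale scale L' using L' by blast
    have "L' t = L t" for t
    proof (induction t rule: qv_induct)
      case (basis mw)
      then show ?case
        using L' L(2) by (cases mw) (metis pure_tensor_monom)
    qed (simp_all add: L.zero L.add L.scale L'.zero L'.add L'.scale)
    then show "L' = L" by blast
  qed
qed

lemma
  shuffle_add_left: "(u + u') \<squnion>\<squnion> v = u \<squnion>\<squnion> v + u' \<squnion>\<squnion> v" and
  shuffle_add_right: "u \<squnion>\<squnion> (v + v') = u \<squnion>\<squnion> v + u \<squnion>\<squnion> v'" and
  shuffle_scale_left: "qscale c u \<squnion>\<squnion> v = qscale c (u \<squnion>\<squnion> v)" and
  shuffle_scale_right: "u \<squnion>\<squnion> qscale c v = qscale c (u \<squnion>\<squnion> v)" and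
  shuffle_zero_left: "0 \<squnion>\<squnion> v = 0" and
  shuffle_zero_right: "u \<squnion>\<squnion> 0 = 0" and
  shuffle_basis: "basis_vec a \<squnion>\<squnion> basis_vec b = shuffle_words a b"
  by (simp_all add: shuffle_prod_def lin_ext_fun_add lin_ext_fun_scale)
     (simp add: lin_ext_def)

lemma
  tensor_mult_add_left: "tensor_mult (s + s') t = tensor_mult s t + tensor_mult s' t" and
  tensor_mult_add_right: "tensor_mult s (t + t') = tensor_mult s t + tensor_mult s t'" and
  tensor_mult_scale_left: "tensor_mult (qscale c s) t = qscale c (tensor_mult s t)" and
  tensor_mult_scale_right: "tensor_mult s (qscale c t) = qscale c (tensor_mult s t)" and
  tensor_mult_zero_left: "tensor_mult 0 t = 0" and
  tensor_mult_zero_right: "tensor_mult s 0 = 0"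
  by (simp_all add: tensor_mult_def lin_ext_fun_add lin_ext_fun_scale case_prod_unfold)
     (simp add: lin_ext_def)

lemma tensor_mult_pure:
  "tensor_mult (p \<otimes> u) (q \<otimes> v) = (p * q) \<otimes> (u \<squnion>\<squnion> v)"
proof -
  note bil = pure_tensor_bilinear
    shuffle_add_left shuffle_add_right shuffle_scale_left shuffle_scale_right
    shuffle_zero_left shuffle_zero_right
    tensor_mult_add_left tensor_mult_add_right tensor_mult_scale_left tensor_mult_scale_right
    tensor_mult_zero_left tensor_mult_zero_right
  have 1: "tensor_mult (monom 1 m \<otimes> basis_vec a) (monom 1 n \<otimes> basis_vec b) =
      (monom 1 m * monom 1 n) \<otimes> (basis_vec a \<squnion>\<squnion> basis_vec b)" for m n and a b :: "'a list"
    by (simp only: pure_tensor_monom) (simp add: tensor_mult_def shuffle_basis mult_monom)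
  have 2: "tensor_mult (monom 1 m \<otimes> basis_vec a) (monom 1 n \<otimes> v) =
      (monom 1 m * monom 1 n) \<otimes> (basis_vec a \<squnion>\<squnion> v)" for m n and a :: "'a list"
    by (induction v rule: qv_induct) (simp_all only: 1 bil)
  have 3: "tensor_mult (monom 1 m \<otimes> u) (monom 1 n \<otimes> v) =
      (monom 1 m * monom 1 n) \<otimes> (u \<squnion>\<squnion> v)" for m n
    by (induction u rule: qv_induct) (simp_all only: 2 bil)
  have 4: "tensor_mult (monom 1 m \<otimes> u) (q \<otimes> v) = (monom 1 m * q) \<otimes> (u \<squnion>\<squnion> v)" for m
    by (induction q rule: poly_lin_induct)
       (simp_all only: 3 bil mult_zero_right distrib_left mult_smult_right)
  show ?thesis
    by (induction p rule: poly_lin_induct)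
       (simp_all only: 4 bil mult_zero_left distrib_right mult_smult_left)
qed


section \<open>The comparison map\<close>

typedef odd_index = "{k::nat. odd k \<and> 3 \<le> k}"
  by (rule exI[of _ 3]) simp

text \<open>The word \<open>f\<^bsub>k\<^sub>1\<^esub> \<dots> f\<^bsub>k\<^sub>r\<^esub>\<close> is the list \<open>[k\<^sub>1, \<dots>, k\<^sub>r]\<close>.\<close>

definition comparison_map :: "odd_index tensor \<Rightarrow> hoffman"
  where "comparison_map = lin_ext (\<lambda>(m, ks).
    shuffle_pow xx_elem m \<squnion>\<squnion> W_elem (map (\<lambda>k. Rep_odd_index k - 2) ks))"

lemma comparison_map_pure:
  "comparison_map (monom 1 m \<otimes> basis_vec ks) =
    shuffle_pow xx_elem m \<squnion>\<squnion> W_elem (map (\<lambda>k. Rep_odd_index k - 2) ks)"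
  by (simp only: pure_tensor_monom) (simp add: comparison_map_def)

definition tensor_algebra_iso_onto :: "hoffman set \<Rightarrow> ('k tensor \<Rightarrow> hoffman) \<Rightarrow> bool"
  where "tensor_algebra_iso_onto S \<Phi> \<longleftrightarrow>
    Vector_Spaces.linear qscale qscale \<Phi> \<and>
    \<Phi> tensor_one = basis_vec [] \<and>
    (\<forall>s t. \<Phi> (tensor_mult s t) = \<Phi> s \<squnion>\<squnion> \<Phi> t) \<and>
    bij_betw \<Phi> UNIV S"

end

theory Submission
  imports Defs
begin

text \<open>
  Write \<open>x\<close>, \<open>y\<close> for the letters and \<open>H\<close> for the shuffle algebra on them.  The half-shuffle algebra of
  the nonempty words over any alphabet is the free Zinbiel algebra on its letters: a choice of a value
  for every letter extends to words by \<open>a w \<mapsto> g(a) \<prec> (value of w)\<close>, and this extension is a Zinbiel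
  homomorphism (\<open>zinbiel_ext_half_shuffle\<close>, and \<open>word_ext_half_shuffle\<close> for an arbitrary target).
  Hence the map \<open>\<theta>\<close> (here \<open>M_embed\<close>) with \<open>x \<mapsto> xx\<close> and \<open>y \<mapsto> W\<^sub>1\<close> is a homomorphism of shuffle
  algebras from \<open>H\<close> onto \<open>M\<close>, and everything follows once \<open>\<theta>\<close> is injective.

  Injectivity (\<open>inj_M_embed\<close>).  If \<open>u = c + x A + y B\<close> then
  \<open>\<theta> u = c + x (x \<squnion>\<squnion> (\<theta> A + y \<squnion>\<squnion> \<theta> B))\<close>.  If this vanishes, then \<open>c = 0\<close>, and since \<open>x\<close> is not a
  zero divisor, \<open>\<theta> A + y \<squnion>\<squnion> \<theta> B = 0\<close>.  No word in the image of \<open>\<theta>\<close> starts with \<open>y\<close>, so the words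
  starting with \<open>y\<close> in this equation contribute exactly \<open>y (\<theta> B)\<close>; thus \<open>\<theta> B = 0\<close> and then
  \<open>\<theta> A = 0\<close>, and induction shows that all coefficients of \<open>u\<close> vanish.

  The basis.  Because \<open>x \<squnion>\<squnion> x = 2 xx\<close>, the generator \<open>W\<^bsub>2k+1\<^esub> = x (x\<^bsup>\<squnion>\<squnion>(2k+1)\<^esup> \<squnion>\<squnion> y)\<close> equals
  \<open>2\<^sup>k W\<^sub>1 \<prec> (xx)\<^bsup>\<squnion>\<squnion>k\<^esup>\<close>, that is, \<open>\<theta>(Y\<^sub>k)\<close> with \<open>Y\<^sub>k = 2\<^sup>k y x\<^bsup>\<squnion>\<squnion>k\<^esup>\<close>.  So the family of the
  theorem is the image under \<open>\<theta>\<close> of the elements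
  \<open>x\<^bsup>\<squnion>\<squnion>m\<^esup> \<squnion>\<squnion> (Y\<^bsub>k\<^sub>1\<^esub> \<prec> (Y\<^bsub>k\<^sub>2\<^esub> \<prec> \<dots>))\<close>.  These form a basis of \<open>H\<close> (\<open>bij_two_letter_basis\<close>): it
  reflects that \<open>H\<close> is free over \<open>\<rat>[x]\<close> on the words that are empty or start with \<open>y\<close>.  The same
  basis shows that \<open>x\<close> is not a zero divisor, as multiplication by \<open>x\<close> merely raises the index \<open>m\<close>.

  The comparison map.  It carries the basis of the tensor product bijectively to this basis of
  \<open>M\<close>, and it is multiplicative since \<open>f\<^bsub>k\<^sub>1\<^esub>\<dots>f\<^bsub>k\<^sub>r\<^esub> \<mapsto> W\<^bsub>k\<^sub>1-2,\<dots>,k\<^sub>r-2\<^esub>\<close> is once more the extension of a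
  choice of values of letters.
\<close>


section \<open>Left derivatives and the shuffle algebra\<close>

text \<open>
  The map removing a leading letter \<open>c\<close>.  It is a derivation of the shuffle product, which turns
  identities between shuffles into inductions on the length of the word whose coefficient is taken.
\<close>

definition left_deriv :: "'a \<Rightarrow> ('a list \<Rightarrow>\<^sub>0 rat) \<Rightarrow> ('a list \<Rightarrow>\<^sub>0 rat)"
  where "left_deriv c = lin_ext (\<lambda>w. case w of [] \<Rightarrow> 0 | a # v \<Rightarrow> if a = c then basis_vec v else 0)"

lemma left_deriv_linear [simp]:
  "left_deriv c (u + v) = left_deriv c u + left_deriv c v"
  "left_deriv c (qscale r u) = qscale r (left_deriv c u)"
  "left_deriv c 0 = 0"
  by (simp_all add: left_deriv_def)

lemma left_deriv_basis [simp]: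
  "left_deriv c (basis_vec []) = 0"
  "left_deriv c (basis_vec (a # v)) = (if a = c then basis_vec v else 0)"
  by (simp_all add: left_deriv_def)

lemma prepend_linear [simp]:
  "prepend c (u + v) = prepend c u + prepend c v"
  "prepend c (qscale r u) = qscale r (prepend c u)"
  "prepend c 0 = 0"
  "prepend c (basis_vec w) = basis_vec (c # w)"
  by (simp_all add: prepend_def)

lemma lookup_left_deriv: "Poly_Mapping.lookup (left_deriv c u) w = Poly_Mapping.lookup u (c # w)"
proof (induction u rule: qv_induct)
  case (basis v)
  show ?case by (cases v) (auto simp: lookup_single when_def)
qed (simp_all add: lookup_add)

lemma add_self_eq_qscale: "u + u = qscale 2 u"
  by (rule poly_mapping_eqI) (simp add: lookup_add)

lemma words_eqI:
  assumes "Poly_Mapping.lookup u [] = Poly_Mapping.lookup v []"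
    and "\<And>c. left_deriv c u = left_deriv c v"
  shows "u = v"
proof (rule poly_mapping_eqI)
  fix w show "Poly_Mapping.lookup u w = Poly_Mapping.lookup v w"
    using assms by (cases w) (simp_all flip: lookup_left_deriv)
qed

lemma left_deriv_prepend [simp]: "left_deriv c (prepend a u) = (if a = c then u else 0)"
  by (induction u rule: qv_induct) auto

lemma lookup_prepend_Nil [simp]: "Poly_Mapping.lookup (prepend a u) [] = 0"
  by (induction u rule: qv_induct) (simp_all add: lookup_add lookup_single)

lemma shuffle_words_Nil2 [simp]: "shuffle_words u [] = basis_vec u"
  by (cases u) auto

lemmas shuffle_bilinear [simp] = shuffle_add_left shuffle_add_right shuffle_scale_left
  shuffle_scale_right shuffle_zero_left shuffle_zero_right

lemma half_shuffle_bilinear [simp]: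
  "(u + u') \<prec> v = u \<prec> v + u' \<prec> v"
  "u \<prec> (v + v') = u \<prec> v + u \<prec> v'"
  "qscale c u \<prec> v = qscale c (u \<prec> v)"
  "u \<prec> qscale c v = qscale c (u \<prec> v)"
  "0 \<prec> v = 0"
  "u \<prec> 0 = 0"
  by (simp_all add: half_shuffle_def lin_ext_fun_add lin_ext_fun_scale)
     (simp add: lin_ext_def)

lemma half_shuffle_basis: "basis_vec a \<prec> basis_vec b = half_shuffle_words a b"
  by (simp add: half_shuffle_def)

lemma bilinear_induct [case_names basis zero_left add_left scale_left zero_right add_right scale_right]:
  assumes "\<And>a b. P (basis_vec a) (basis_vec b)"
    and "\<And>v. P 0 v" "\<And>u u' v. P u v \<Longrightarrow> P u' v \<Longrightarrow> P (u + u') v" "\<And>c u v. P u v \<Longrightarrow> P (qscale c u) v"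
    and "\<And>u. P u 0" "\<And>u v v'. P u v \<Longrightarrow> P u v' \<Longrightarrow> P u (v + v')" "\<And>c u v. P u v \<Longrightarrow> P u (qscale c v)"
  shows "P u v"
proof (induction u rule: qv_induct)
  case (basis a)
  show ?case by (induction v rule: qv_induct) (use assms in auto)
qed (use assms in auto)

lemma lookup_shuffle_Nil [simp]:
  "Poly_Mapping.lookup (u \<squnion>\<squnion> v) [] = Poly_Mapping.lookup u [] * Poly_Mapping.lookup v []"
proof (induction u v rule: bilinear_induct)
  case (basis a b)
  show ?case by (cases a; cases b) (simp_all add: shuffle_basis lookup_add lookup_single)
qed (simp_all add: lookup_add algebra_simps)

text \<open>
  The first letter of a shuffle comes from one of the two factors.
\<close>

lemma left_deriv_shuffle [simp]:
  "left_deriv c (u \<squnion>\<squnion> v) = left_deriv c u \<squnion>\<squnion> v + u \<squnion>\<squnion> left_deriv c v"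
proof (induction u v rule: bilinear_induct)
  case (basis a b)
  show ?case by (cases a; cases b) (simp_all add: shuffle_basis)
qed (simp_all add: algebra_simps qv.scale_right_distrib)

lemma lookup_half_shuffle_Nil [simp]: "Poly_Mapping.lookup (u \<prec> v) [] = 0"
proof (induction u v rule: bilinear_induct)
  case (basis a b)
  show ?case by (cases a) (simp_all add: half_shuffle_basis)
qed (simp_all add: lookup_add algebra_simps)

lemma left_deriv_half_shuffle [simp]: "left_deriv c (u \<prec> v) = left_deriv c u \<squnion>\<squnion> v"
proof (induction u v rule: bilinear_induct)
  case (basis a b)
  show ?case by (cases a) (simp_all add: half_shuffle_basis shuffle_basis)
qed (simp_all add: algebra_simps qv.scale_right_distrib)

text \<open>
  Both sides have the same constant term, and the derivation rule expresses the left derivatives of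
  both sides by instances of the same identity; so coefficients agree by induction on the word.
\<close>

lemma shuffle_commute: "u \<squnion>\<squnion> v = v \<squnion>\<squnion> u"
proof (rule poly_mapping_eqI)
  show "Poly_Mapping.lookup (u \<squnion>\<squnion> v) w = Poly_Mapping.lookup (v \<squnion>\<squnion> u) w" for w
  proof (induction w arbitrary: u v)
    case (Cons c w)
    then show ?case
      by (simp add: lookup_add add.commute flip: lookup_left_deriv)
  qed simp
qed

lemma shuffle_assoc: "(u \<squnion>\<squnion> v) \<squnion>\<squnion> w = u \<squnion>\<squnion> (v \<squnion>\<squnion> w)"
proof (rule poly_mapping_eqI)
  show "Poly_Mapping.lookup ((u \<squnion>\<squnion> v) \<squnion>\<squnion> w) z = Poly_Mapping.lookup (u \<squnion>\<squnion> (v \<squnion>\<squnion> w)) z" for z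
  proof (induction z arbitrary: u v w)
    case (Cons c z)
    then show ?case
      by (simp add: lookup_add add.assoc flip: lookup_left_deriv)
  qed simp
qed

lemma shuffle_Nil_left [simp]: "basis_vec [] \<squnion>\<squnion> u = u"
  by (induction u rule: qv_induct) (simp_all add: shuffle_basis)

global_interpretation shuffle: comm_monoid "(\<squnion>\<squnion>)" "basis_vec []"
proof
  show "u \<squnion>\<squnion> basis_vec [] = u" for u :: "'a list \<Rightarrow>\<^sub>0 rat"
    using shuffle_commute[of u "basis_vec []"] by simp
qed (rule shuffle_assoc shuffle_commute)+

text \<open>
  This is the Zinbiel identity, in a form that includes constant terms: the shuffle on the right
  is the symmetrized half-shuffle whenever one factor has no constant term.
\<close>

lemma half_shuffle_assoc: "(u \<prec> v) \<prec> w = u \<prec> (v \<squnion>\<squnion> w)"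
  by (rule words_eqI) (simp_all add: shuffle_assoc)

text \<open>
  The constant term must vanish in one factor, since \<open>1 \<squnion>\<squnion> 1 = 1\<close> while both half-shuffles of \<open>1\<close>
  with itself are \<open>0\<close>.
\<close>

lemma shuffle_eq_half_shuffles:
  assumes "Poly_Mapping.lookup u [] = 0"
  shows "u \<squnion>\<squnion> v = u \<prec> v + v \<prec> u"
  by (rule words_eqI) (simp_all add: assms lookup_add shuffle.commute)

lemma half_shuffle_Nil_right:
  assumes "Poly_Mapping.lookup u [] = 0"
  shows "u \<prec> basis_vec [] = u"
  by (rule words_eqI) (simp_all add: assms)

lemma prepend_eq_half_shuffle: "prepend a u = basis_vec [a] \<prec> u"
  by (rule words_eqI) auto

lemma shuffle_pow_add: "shuffle_pow u (m + n) = shuffle_pow u m \<squnion>\<squnion> shuffle_pow u n"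
  by (induction m) (simp_all add: shuffle_assoc)

lemma lookup_shuffle_pow_Nil:
  "Poly_Mapping.lookup (shuffle_pow u m) [] = Poly_Mapping.lookup u [] ^ m"
  by (induction m) (simp_all add: lookup_single)

lemma left_deriv_shuffle_pow:
  "left_deriv c (shuffle_pow u m) = qscale (of_nat m) (shuffle_pow u (m - 1) \<squnion>\<squnion> left_deriv c u)"
proof (induction m)
  case (Suc m)
  have "u \<squnion>\<squnion> qscale (of_nat m) (shuffle_pow u (m - 1) \<squnion>\<squnion> left_deriv c u) =
      qscale (of_nat m) (shuffle_pow u m \<squnion>\<squnion> left_deriv c u)"
    by (cases m) (simp_all add: shuffle_assoc)
  then show ?case
    by (simp only: shuffle_pow.simps left_deriv_shuffle Suc)
       (simp add: shuffle.commute qv.scale_left_distrib)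
qed simp


section \<open>The half-shuffle algebra of nonempty words is free\<close>

text \<open>
  The right-nested product \<open>g a\<^sub>1 \<prec> (g a\<^sub>2 \<prec> (\<dots> \<prec> g a\<^sub>r))\<close>.  Folding from the empty word makes
  it defined on the empty word too; this leaves the other values unchanged as long as \<open>g\<close> takes
  values without constant term, because then \<open>g a \<prec> 1 = g a\<close>.
\<close>

definition zinbiel_word :: "('a \<Rightarrow> ('b list \<Rightarrow>\<^sub>0 rat)) \<Rightarrow> 'a list \<Rightarrow> ('b list \<Rightarrow>\<^sub>0 rat)"
  where "zinbiel_word g w = foldr (\<lambda>a v. g a \<prec> v) w (basis_vec [])"

lemma zinbiel_word_simps [simp]:
  "zinbiel_word g [] = basis_vec []"
  "zinbiel_word g (a # w) = g a \<prec> zinbiel_word g w"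
  by (simp_all add: zinbiel_word_def)

abbreviation zinbiel_ext :: "('a \<Rightarrow> ('b list \<Rightarrow>\<^sub>0 rat)) \<Rightarrow> ('a list \<Rightarrow>\<^sub>0 rat) \<Rightarrow> ('b list \<Rightarrow>\<^sub>0 rat)"
  where "zinbiel_ext g \<equiv> lin_ext (zinbiel_word g)"

lemma zinbiel_ext_prepend: "zinbiel_ext g (prepend a u) = g a \<prec> zinbiel_ext g u"
  by (induction u rule: qv_induct) simp_all

lemma zinbiel_ext_letter:
  assumes "Poly_Mapping.lookup (g a) [] = 0"
  shows "zinbiel_ext g (basis_vec [a]) = g a"
  by (simp add: assms half_shuffle_Nil_right)

text \<open>
  Splitting a shuffle of \<open>a u\<close> and \<open>b v\<close> by its first letter and applying the induction hypothesis
  gives \<open>g a \<prec> (U \<squnion>\<squnion> V') + g b \<prec> (V \<squnion>\<squnion> U')\<close> with \<open>U\<close>, \<open>V\<close>, \<open>U' = g a \<prec> U\<close>, \<open>V' = g b \<prec> V\<close>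
  the images of \<open>u\<close>, \<open>v\<close>, \<open>a u\<close>, \<open>b v\<close>.  By the Zinbiel identity this is
  \<open>U' \<prec> V' + V' \<prec> U' = U' \<squnion>\<squnion> V'\<close>.
\<close>

lemma zinbiel_ext_shuffle:
  assumes g: "\<And>a. Poly_Mapping.lookup (g a) [] = 0"
  shows "zinbiel_ext g (u \<squnion>\<squnion> v) = zinbiel_ext g u \<squnion>\<squnion> zinbiel_ext g v"
proof (induction u v rule: bilinear_induct)
  case (basis u v)
  have "zinbiel_ext g (shuffle_words u v) = zinbiel_word g u \<squnion>\<squnion> zinbiel_word g v"
  proof (induction u v rule: shuffle_words.induct)
    case (3 a u b v)
    let ?Z = "zinbiel_word g"
    have "zinbiel_ext g (shuffle_words (a # u) (b # v)) =
        g a \<prec> (?Z u \<squnion>\<squnion> ?Z (b # v)) + g b \<prec> (?Z v \<squnion>\<squnion> ?Z (a # u))"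
      by (simp only: shuffle_words.simps lin_ext_add zinbiel_ext_prepend 3 shuffle.commute)
    also have "\<dots> = ?Z (a # u) \<prec> ?Z (b # v) + ?Z (b # v) \<prec> ?Z (a # u)"
      by (simp add: half_shuffle_assoc)
    also have "\<dots> = ?Z (a # u) \<squnion>\<squnion> ?Z (b # v)"
      by (simp add: shuffle_eq_half_shuffles)
    finally show ?case .
  qed simp_all
  then show ?case by (simp add: shuffle_basis)
qed simp_all

lemma zinbiel_ext_half_shuffle:
  assumes g: "\<And>a. Poly_Mapping.lookup (g a) [] = 0"
  shows "zinbiel_ext g (u \<prec> v) = zinbiel_ext g u \<prec> zinbiel_ext g v"
proof (induction u v rule: bilinear_induct)
  case (basis u v)
  show ?case
  proof (cases u)
    case Nil
    have "basis_vec [] \<prec> w = 0" for w :: "'b list \<Rightarrow>\<^sub>0 rat"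
      by (rule words_eqI) simp_all
    with Nil show ?thesis by (simp add: half_shuffle_basis)
  next
    case (Cons a u')
    then show ?thesis
      by (simp add: half_shuffle_basis zinbiel_ext_prepend half_shuffle_assoc zinbiel_ext_shuffle[OF g]
          flip: shuffle_basis)
  qed
qed simp_all

lemma zinbiel_ext_shuffle_pow:
  assumes "\<And>a. Poly_Mapping.lookup (g a) [] = 0"
  shows "zinbiel_ext g (shuffle_pow u m) = shuffle_pow (zinbiel_ext g u) m"
  by (induction m) (simp_all add: zinbiel_ext_shuffle assms)

lemma zinbiel_ext_zinbiel_word:
  assumes "\<And>a. Poly_Mapping.lookup (g a) [] = 0"
  shows "zinbiel_ext g (zinbiel_word h w) = zinbiel_word (\<lambda>a. zinbiel_ext g (h a)) w"
  by (induction w) (simp_all add: zinbiel_ext_half_shuffle assms)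

lemma H_pos_eq: "H_pos = {u. Poly_Mapping.lookup u [] = 0}"
proof (intro set_eqI iffI)
  fix u assume "u \<in> H_pos"
  then show "u \<in> {u. Poly_Mapping.lookup u [] = 0}"
    unfolding H_pos_def
    by (induction rule: qv.span_induct_alt) (auto simp: lookup_add lookup_single when_def)
next
  fix u :: hoffman assume u: "u \<in> {u. Poly_Mapping.lookup u [] = 0}"
  have "(\<Sum>w\<in>Poly_Mapping.keys u. qscale (Poly_Mapping.lookup u w) (basis_vec w)) \<in> H_pos"
    unfolding H_pos_def
  proof (intro qv.span_sum qv.span_scale qv.span_base imageI)
    fix w assume "w \<in> Poly_Mapping.keys u"
    with u show "w \<in> {w. w \<noteq> []}" by (auto simp: in_keys_iff)
  qed
  then show "u \<in> H_pos" by (simp flip: keys_expansion)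
qed

context zinbiel_algebra
begin

lemma zero_mem: "0 \<in> A"
  and add_mem: "u \<in> A \<Longrightarrow> v \<in> A \<Longrightarrow> u + v \<in> A"
  and scale_mem: "u \<in> A \<Longrightarrow> scale c u \<in> A"
  using subspace_carrier by (auto simp: subspace_def)

lemma prec_zero_left: "v \<in> A \<Longrightarrow> prec 0 v = 0"
  using prec_scale_left[of 0 v 0] zero_mem by simp

lemma prec_zero_right: "u \<in> A \<Longrightarrow> prec u 0 = 0"
  using prec_scale_right[of u 0 0] zero_mem by simp

text \<open>
  The analogue of \<open>zinbiel_word\<close> in an arbitrary Zinbiel algebra.  As there need not be a unit, the
  recursion ends at words of length one, and the value \<open>0\<close> on the empty word is a mere default.
\<close>

fun word_value :: "('a \<Rightarrow> 'v) \<Rightarrow> 'a list \<Rightarrow> 'v"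
  where
    "word_value g [] = 0"
  | "word_value g [a] = g a"
  | "word_value g (a # w) = prec (g a) (word_value g w)"

definition word_ext :: "('a \<Rightarrow> 'v) \<Rightarrow> ('a list \<Rightarrow>\<^sub>0 rat) \<Rightarrow> 'v"
  where "word_ext g u =
    (\<Sum>w\<in>Poly_Mapping.keys u. scale (Poly_Mapping.lookup u w) (word_value g w))"

lemma word_ext_linear [simp]:
  "word_ext g (u + v) = word_ext g u + word_ext g v"
  "word_ext g (qscale c u) = scale c (word_ext g u)"
  "word_ext g 0 = 0"
  "word_ext g (basis_vec w) = word_value g w"
proof -
  note * = linear_extend[OF vector_space_axioms, of "word_value g", folded word_ext_def]
  interpret L: Vector_Spaces.linear qscale scale "word_ext g" using *(1) by simp
  show "word_ext g (u + v) = word_ext g u + word_ext g v"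
    "word_ext g (qscale c u) = scale c (word_ext g u)" "word_ext g 0 = 0"
    by (rule L.add L.scale L.zero)+
  show "word_ext g (basis_vec w) = word_value g w" by (simp add: word_ext_def)
qed

context
  fixes g :: "'a \<Rightarrow> 'v"
  assumes g: "\<And>a. g a \<in> A"
begin

lemma word_value_mem: "word_value g w \<in> A"
  by (induction w rule: induct_list012) (use g in \<open>auto simp: zero_mem prec_closed\<close>)

lemma word_ext_mem: "word_ext g u \<in> A"
  by (induction u rule: qv_induct) (simp_all add: zero_mem add_mem scale_mem word_value_mem)

lemma word_ext_prepend:
  "word_ext g (prepend a u) = scale (Poly_Mapping.lookup u []) (g a) + prec (g a) (word_ext g u)"
proof (induction u rule: qv_induct)
  case (basis w)
  show ?case by (cases w) (simp_all add: lookup_single prec_zero_right g)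
qed (simp_all add: lookup_add g word_ext_mem prec_add_right prec_scale_right prec_zero_right
      scale_left_distrib scale_right_distrib)

text \<open>
  Write \<open>u = a u'\<close>.  For nonempty \<open>u'\<close> the shuffle of \<open>u'\<close> and \<open>v\<close> is the sum of two half-shuffles,
  to which the induction hypothesis applies; the Zinbiel identity of the target reassembles them.
  The second half-shuffle has \<open>u'\<close> and \<open>v\<close> exchanged, hence the induction on the total length.
\<close>

lemma word_ext_half_shuffle_words:
  assumes "u \<noteq> []" "v \<noteq> []"
  shows "word_ext g (half_shuffle_words u v) = prec (word_value g u) (word_value g v)"
  using assms
proof (induction "length u + length v" arbitrary: u v rule: less_induct)
  case less
  obtain a u' where u: "u = a # u'" using less.prems by (cases u) auto
  show ?case
  proof (cases u')
    case Nil
    with u less.prems show ?thesis by (cases v) simp_all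
  next
    case (Cons b u'')
    then have ne: "u' \<noteq> []" by simp
    have *: "shuffle_words u' v = half_shuffle_words u' v + half_shuffle_words v u'"
      using shuffle_eq_half_shuffles[of "basis_vec u'" "basis_vec v"] ne
      by (simp add: shuffle_basis half_shuffle_basis lookup_single)
    have eps: "Poly_Mapping.lookup (half_shuffle_words u' v + half_shuffle_words v u') [] = 0"
      by (simp add: lookup_add flip: half_shuffle_basis)
    have "word_ext g (half_shuffle_words u v) =
        prec (g a) (prec (word_value g u') (word_value g v) + prec (word_value g v) (word_value g u'))"
      using less u ne by (simp add: * word_ext_prepend eps[unfolded lookup_add] lookup_add
          del: prepend_linear)
    also have "\<dots> = prec (prec (g a) (word_value g u')) (word_value g v)"
      by (simp add: zinbiel prec_add_right prec_closed g word_value_mem)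
    finally show ?thesis using u Cons by simp
  qed
qed

text \<open>
  The second summand accounts for \<open>u \<prec> 1 = u\<close>, where \<open>1\<close> is mapped to the default \<open>0\<close>.  With it
  the formula is bilinear in all elements, and on elements without constant term it says that the
  extension is a Zinbiel homomorphism.
\<close>

lemma word_ext_half_shuffle:
  "word_ext g (u \<prec> v) =
    prec (word_ext g u) (word_ext g v) + scale (Poly_Mapping.lookup v []) (word_ext g u)"
proof (induction u v rule: bilinear_induct)
  case (basis u v)
  show ?case
  proof (cases "u = [] \<or> v = []")
    case True
    then show ?thesis
      by (cases u) (auto simp: half_shuffle_basis lookup_single prec_zero_left prec_zero_right
          word_value_mem)
  next
    case False
    then show ?thesis
      by (simp add: half_shuffle_basis word_ext_half_shuffle_words lookup_single)
  qed
qed (simp_all add: lookup_add prec_zero_left prec_zero_right prec_add_left prec_add_right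
      prec_scale_left prec_scale_right word_ext_mem algebra_simps scale_left_distrib
      scale_right_distrib)

end

end


section \<open>Bases of free vector spaces\<close>

lemma range_lin_ext: "range (lin_ext b) = qv.span (range b)"
proof
  show "range (lin_ext b) \<subseteq> qv.span (range b)"
    unfolding lin_ext_def by (blast intro: qv.span_sum qv.span_scale qv.span_base)
  show "qv.span (range b) \<subseteq> range (lin_ext b)"
  proof
    fix v assume "v \<in> qv.span (range b)"
    then show "v \<in> range (lin_ext b)"
    proof (induction rule: qv.span_induct_alt)
      case base
      show ?case using lin_ext_zero[of b] by (metis rangeI)
    next
      case (step c x y)
      then obtain i u where "x = lin_ext b (basis_vec i)" "y = lin_ext b u" by auto
      then have "qscale c x + y = lin_ext b (qscale c (basis_vec i) + u)" by simp
      then show ?case by blast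
    qed
  qed
qed

lemma inj_lin_extI:
  assumes "\<And>u. lin_ext b u = 0 \<Longrightarrow> u = 0"
  shows "inj (lin_ext b)"
proof (rule injI)
  interpret L: Vector_Spaces.linear qscale qscale "lin_ext b" by (rule linear_lin_ext)
  fix u v assume "lin_ext b u = lin_ext b v"
  then have "lin_ext b (u - v) = 0" by (simp add: L.diff)
  then show "u = v" using assms by force
qed

lemma is_basis_family_iff_bij:
  "is_basis_family qscale UNIV b V \<longleftrightarrow> bij_betw (lin_ext b) UNIV V"
proof -
  have "inj b \<and> \<not> qv.dependent (range b) \<longleftrightarrow> inj (lin_ext b)"
  proof (intro iffI conjI)
    assume *: "inj b \<and> \<not> qv.dependent (range b)"
    show "inj (lin_ext b)"
    proof (rule inj_lin_extI)
      fix u assume u: "lin_ext b u = 0"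
      have inj: "inj b" using * by simp
      have "(\<Sum>v\<in>b ` Poly_Mapping.keys u. qscale (Poly_Mapping.lookup u (inv b v)) v) = lin_ext b u"
        using inj by (simp add: lin_ext_def sum.reindex inj_on_subset)
      then have "Poly_Mapping.lookup u (inv b v) = 0" if "v \<in> b ` Poly_Mapping.keys u" for v
        using * u that
          qv.independentD[of "range b" "b ` Poly_Mapping.keys u" "\<lambda>v. Poly_Mapping.lookup u (inv b v)" v]
        by auto
      then show "u = 0"
        using inj by (intro poly_mapping_eqI) (force simp: in_keys_iff)
    qed
  next
    assume inj: "inj (lin_ext b)"
    show "inj b"
    proof (rule injI)
      fix i j assume "b i = b j"
      then have "basis_vec i = basis_vec j" using inj by (auto dest!: injD[of _ "basis_vec i" "basis_vec j"])
      then show "i = j" by (metis lookup_single_eq lookup_single_not_eq zero_neq_one)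
    qed
    show "\<not> qv.dependent (range b)"
      unfolding qv.independent_explicit_module
    proof (intro allI impI)
      fix t f v assume t: "finite t" "t \<subseteq> range b" "(\<Sum>v\<in>t. qscale (f v) v) = 0" "v \<in> t"
      from t obtain K where K: "finite K" "t = b ` K" by (meson finite_subset_image)
      define u where "u = (\<Sum>i\<in>K. qscale (f (b i)) (basis_vec i))"
      interpret L: Vector_Spaces.linear qscale qscale "lin_ext b" by (rule linear_lin_ext)
      have "lin_ext b u = (\<Sum>i\<in>K. qscale (f (b i)) (b i))"
        unfolding u_def by (simp add: L.sum)
      also have "\<dots> = 0"
        using t(3) K \<open>inj b\<close> by (simp add: sum.reindex inj_on_subset)
      finally have "u = 0" using injD[OF inj, of u 0] by simp
      moreover have "Poly_Mapping.lookup u i = f (b i)" if "i \<in> K" for i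
        using K that by (simp add: u_def lookup_sum lookup_single when_def if_distrib cong: if_cong)
      ultimately show "f v = 0" using t K by auto
    qed
  qed
  then show ?thesis
    by (auto simp: is_basis_family_def bij_betw_def range_lin_ext)
qed

lemma is_basis_family_reindex:
  assumes "bij_betw r I J"
  shows "is_basis_family scale I (b \<circ> r) V \<longleftrightarrow> is_basis_family scale J b V"
proof -
  have "(b \<circ> r) ` I = b ` J" "inj_on (b \<circ> r) I \<longleftrightarrow> inj_on b J"
    using assms by (auto simp: bij_betw_def comp_inj_on_iff)
  then show ?thesis by (simp add: is_basis_family_def)
qed


section \<open>The shuffle algebra on two letters is free over the polynomials in \<open>x\<close>\<close>

text \<open>
  The factor \<open>2\<^sup>k\<close> makes this element correspond to \<open>W\<^bsub>2k+1\<^esub>\<close>; see \<open>M_embed_y_gen\<close>.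
\<close>

definition y_gen :: "nat \<Rightarrow> hoffman"
  where "y_gen k = qscale (2 ^ k) (prepend Ly (shuffle_pow (basis_vec [Lx]) k))"

definition two_letter_basis :: "nat \<times> nat list \<Rightarrow> hoffman"
  where "two_letter_basis = (\<lambda>(m, ks). shuffle_pow (basis_vec [Lx]) m \<squnion>\<squnion> zinbiel_word y_gen ks)"

text \<open>
  The left derivatives in the coordinates given by \<open>two_letter_basis\<close>: \<open>x\<close>-derivation kills every
  half-shuffle product of the \<open>y_gen k\<close> and differentiates the power of \<open>x\<close>, while \<open>y\<close>-derivation
  removes the \<open>y\<close> of the first factor \<open>y_gen k\<close>, whose \<open>x\<^bsup>\<squnion>\<squnion>k\<^esup>\<close> joins the power of \<open>x\<close> in front.
\<close>

definition index_deriv :: "letter \<Rightarrow> nat \<times> nat list \<Rightarrow> (nat \<times> nat list \<Rightarrow>\<^sub>0 rat)"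
  where "index_deriv c = (\<lambda>(m, ks). case c of
      Lx \<Rightarrow> qscale (of_nat m) (basis_vec (m - 1, ks))
    | Ly \<Rightarrow> (case ks of [] \<Rightarrow> 0 | k # ks' \<Rightarrow> qscale (2 ^ k) (basis_vec (m + k, ks'))))"

lemma left_deriv_two_letter_basis:
  "left_deriv c (lin_ext two_letter_basis u) = lin_ext two_letter_basis (lin_ext (index_deriv c) u)"
proof (induction u rule: qv_induct)
  case (basis i)
  obtain m ks where i: "i = (m, ks)" by (cases i)
  have pow: "left_deriv c (shuffle_pow (basis_vec [Lx]) m) =
      (if c = Lx then qscale (of_nat m) (shuffle_pow (basis_vec [Lx]) (m - 1)) else 0)" for c
    by (auto simp: left_deriv_shuffle_pow)
  show ?case
    by (cases c; cases ks)
      (simp_all add: i two_letter_basis_def index_deriv_def pow y_gen_def shuffle_pow_add shuffle_assoc)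
qed simp_all

lemma lookup_index_deriv_Lx:
  "Poly_Mapping.lookup (lin_ext (index_deriv Lx) u) (m, ks) =
    of_nat (Suc m) * Poly_Mapping.lookup u (Suc m, ks)"
proof (induction u rule: qv_induct)
  case (basis i)
  then show ?case
    by (cases i; cases "fst i") (auto simp: index_deriv_def lookup_single when_def)
qed (simp_all add: lookup_add algebra_simps)

lemma lookup_index_deriv_Ly:
  "Poly_Mapping.lookup (lin_ext (index_deriv Ly) u) (n, ks) =
    (\<Sum>m\<le>n. 2 ^ (n - m) * Poly_Mapping.lookup u (m, (n - m) # ks))"
proof (induction u rule: qv_induct)
  case (basis i)
  obtain m ks' where i: "i = (m, ks')" by (cases i)
  show ?case
  proof (cases ks')
    case Nil
    then show ?thesis by (simp add: i index_deriv_def lookup_single)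
  next
    case (Cons k ks'')
    have "(\<Sum>j\<le>n. 2 ^ (n - j) * Poly_Mapping.lookup (basis_vec i :: _ \<Rightarrow>\<^sub>0 rat) (j, (n - j) # ks)) =
        (\<Sum>j\<le>n. if j = m then (if k = n - m \<and> ks'' = ks then 2 ^ (n - m) else 0) else 0)"
      by (rule sum.cong) (auto simp: i Cons lookup_single when_def)
    also have "\<dots> = (if m + k = n \<and> ks'' = ks then 2 ^ k else 0)"
      by (auto simp: sum.delta)
    finally show ?thesis
      by (simp add: i Cons index_deriv_def lookup_single when_def)
  qed
qed (simp_all add: lookup_add sum.distrib sum_distrib_left algebra_simps)

lemma lookup_two_letter_basis_Nil:
  "Poly_Mapping.lookup (lin_ext two_letter_basis u) [] = Poly_Mapping.lookup u (0, [])"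
proof (induction u rule: qv_induct)
  case (basis i)
  obtain m ks where i: "i = (m, ks)" by (cases i)
  show ?case
    by (cases ks) (auto simp: i two_letter_basis_def lookup_shuffle_pow_Nil lookup_single when_def)
qed (simp_all add: lookup_add)

text \<open>
  The kernel is stable under both index derivatives.  Coefficients of its elements vanish by
  induction on the weight \<open>m + \<Sum>(k\<^sub>i + 1)\<close>, the degree of the basis element: the \<open>x\<close>-derivative
  handles \<open>m > 0\<close>, and the \<open>y\<close>-derivative then isolates a single term with \<open>m = 0\<close>.
\<close>

lemma inj_two_letter_basis: "inj (lin_ext two_letter_basis)"
proof (rule inj_lin_extI, rule poly_mapping_eqI)
  fix u i
  assume "lin_ext two_letter_basis u = 0"
  then have "Poly_Mapping.lookup u i = 0"
  proof (induction "fst i + (\<Sum>k\<leftarrow>snd i. Suc k)" arbitrary: u i rule: less_induct)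
    case less
    have ker: "lin_ext two_letter_basis (lin_ext (index_deriv c) u) = 0" for c
      by (simp add: less.prems flip: left_deriv_two_letter_basis)
    have pos: "Poly_Mapping.lookup u (Suc m, ks) = 0"
      if "m + (\<Sum>k\<leftarrow>ks. Suc k) < fst i + (\<Sum>k\<leftarrow>snd i. Suc k)" for m ks
      using less.hyps[OF _ ker[of Lx], of "(m, ks)"] that by (simp add: lookup_index_deriv_Lx)
    obtain m ks where i: "i = (m, ks)" by (cases i)
    consider m' where "m = Suc m'" | "m = 0" "ks = []" | k ks' where "m = 0" "ks = k # ks'"
      by (cases m; cases ks) auto
    then show ?case
    proof cases
      case 1
      then show ?thesis using pos i by simp
    next
      case 2
      then show ?thesis using i less.prems lookup_two_letter_basis_Nil[of u] by simp
    next
      case 3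
      \<comment> \<open>All terms of this sum have the weight of the index \<open>i\<close>, so the induction hypothesis does not apply
        to them directly; those with \<open>m > 0\<close> vanish by \<open>pos\<close>.\<close>
      have "0 = (\<Sum>m\<le>k. 2 ^ (k - m) * Poly_Mapping.lookup u (m, (k - m) # ks'))"
        using less.hyps[OF _ ker[of Ly], of "(k, ks')"] by (simp add: i 3 lookup_index_deriv_Ly)
      also have "\<dots> = (\<Sum>m\<le>k. if m = 0 then 2 ^ k * Poly_Mapping.lookup u (0, k # ks') else 0)"
      proof (rule sum.cong)
        fix m assume "m \<in> {..k}"
        then show "2 ^ (k - m) * Poly_Mapping.lookup u (m, (k - m) # ks') =
            (if m = 0 then 2 ^ k * Poly_Mapping.lookup u (0, k # ks') else 0)"
          using pos[of "m - 1" "(k - m) # ks'"] by (cases m) (simp_all add: i 3)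
      qed simp
      finally show ?thesis by (simp add: i 3)
    qed
  qed
  then show "Poly_Mapping.lookup u i = Poly_Mapping.lookup 0 i" by simp
qed

text \<open>
  The range is stable under shuffling with \<open>x\<close> and under prepending \<open>y\<close>, both of which map
  basis elements to scalar multiples of basis elements.  It remains to prepend powers of \<open>x\<close> to
  words \<open>y u\<close>, which follows from
  \<open>x \<squnion>\<squnion> x\<^sup>n y u = (n + 1) x\<^bsup>n+1\<^esup> y u + x\<^sup>n y (x \<squnion>\<squnion> u)\<close> by induction on \<open>n\<close>.
\<close>

lemma range_two_letter_basis: "range (lin_ext two_letter_basis) = UNIV"
proof -
  define S where "S = range (lin_ext two_letter_basis)"
  have S: "qv.subspace S" by (simp add: S_def range_lin_ext)
  have base: "two_letter_basis i \<in> S" for i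
    unfolding S_def by (rule range_eqI[of _ _ "basis_vec i"]) simp
  \<comment> \<open>A linear map preserves the range if it sends every basis element into it.\<close>
  have lin: "f u \<in> S" if "u \<in> S" "\<And>i. f (two_letter_basis i) \<in> S"
    "\<And>u v. f (u + v) = f u + f v" "\<And>c u. f (qscale c u) = qscale c (f u)" for f u
  proof -
    have "f 0 = 0" using that(4)[of 0 0] by simp
    have "f (lin_ext two_letter_basis t) \<in> S" for t
      by (induction t rule: qv_induct)
         (simp_all add: that \<open>f 0 = 0\<close> S qv.subspace_0 qv.subspace_add qv.subspace_scale)
    with that(1) show ?thesis by (auto simp: S_def)
  qed
  have x: "basis_vec [Lx] \<squnion>\<squnion> u \<in> S" if "u \<in> S" for u
    using that
  proof (rule lin)
    fix i show "basis_vec [Lx] \<squnion>\<squnion> two_letter_basis i \<in> S"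
      using base[of "(Suc (fst i), snd i)"]
      by (cases i) (simp add: two_letter_basis_def shuffle_assoc)
  qed simp_all
  have y: "prepend Ly u \<in> S" if "u \<in> S" for u
    using that
  proof (rule lin)
    fix i :: "nat \<times> nat list"
    obtain m ks where i: "i = (m, ks)" by (cases i)
    have "two_letter_basis (0, m # ks) = qscale (2 ^ m) (prepend Ly (two_letter_basis i))"
      by (simp add: i two_letter_basis_def y_gen_def prepend_eq_half_shuffle half_shuffle_assoc)
    then have "prepend Ly (two_letter_basis i) = qscale (1 / 2 ^ m) (two_letter_basis (0, m # ks))"
      by simp
    then show "prepend Ly (two_letter_basis i) \<in> S"
      using base S by (simp add: qv.subspace_scale)
  qed simp_all
  \<comment> \<open>The induction hypothesis is needed for \<open>u\<close> and for \<open>x \<squnion>\<squnion> u\<close>.\<close>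
  have xy: "(prepend Lx ^^ n) (prepend Ly u) \<in> S" if "u \<in> S" for n u
    using that
  proof (induction n arbitrary: u)
    case (Suc n)
    have step: "basis_vec [Lx] \<squnion>\<squnion> (prepend Lx ^^ n) (prepend Ly u) =
        qscale (of_nat (Suc n)) ((prepend Lx ^^ Suc n) (prepend Ly u)) +
        (prepend Lx ^^ n) (prepend Ly (basis_vec [Lx] \<squnion>\<squnion> u))"
    proof (induction n)
      case 0
      show ?case by (rule words_eqI) (auto simp: lookup_add lookup_single)
    next
      case (Suc n)
      have "basis_vec [Lx] \<squnion>\<squnion> (prepend Lx ^^ Suc n) (prepend Ly u) =
          (prepend Lx ^^ Suc (Suc n)) (prepend Ly u) +
          prepend Lx (basis_vec [Lx] \<squnion>\<squnion> (prepend Lx ^^ n) (prepend Ly u))"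
        by (rule words_eqI) (auto simp: lookup_add lookup_single)
      then show ?case
        by (simp only: Suc) (simp add: qv.scale_left_distrib add_self_eq_qscale)
    qed
    have "(prepend Lx ^^ Suc n) (prepend Ly u) = qscale (1 / of_nat (Suc n))
        (basis_vec [Lx] \<squnion>\<squnion> (prepend Lx ^^ n) (prepend Ly u) -
         (prepend Lx ^^ n) (prepend Ly (basis_vec [Lx] \<squnion>\<squnion> u)))"
      by (simp only: step) simp
    also have "\<dots> \<in> S"
      by (intro qv.subspace_scale[OF S] qv.subspace_diff[OF S] x Suc)
    finally show ?case .
  qed (simp add: y)
  have "basis_vec w \<in> S" for w
  proof (induction "length w" arbitrary: w rule: less_induct)
    case less
    show ?case
    proof (cases "Ly \<in> set w")
      case True
      then obtain v w' where w: "w = v @ Ly # w'" "Ly \<notin> set v" by (meson split_list_first)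
      have "(prepend Lx ^^ length v) (basis_vec (Ly # w')) = basis_vec (v @ Ly # w')"
        using w(2)
      proof (induction v)
        case (Cons a v)
        then show ?case by (cases a) simp_all
      qed simp
      with xy[of "basis_vec w'" "length v"] less w show ?thesis by simp
    next
      case False
      have "shuffle_pow (basis_vec [Lx]) n = qscale (fact n) (basis_vec (replicate n Lx))" for n
      proof (induction n)
        case (Suc n)
        have "shuffle_words [Lx] (replicate n Lx) = qscale (of_nat (Suc n)) (basis_vec (replicate (Suc n) Lx))"
          by (induction n) (simp_all add: qv.scale_left_distrib add_self_eq_qscale)
        then show ?case by (simp add: Suc shuffle_basis)
      qed simp
      then have "basis_vec (replicate n Lx) = qscale (1 / fact n) (two_letter_basis (n, []))" for n
        by (simp add: two_letter_basis_def)
      moreover have "w = replicate (length w) Lx"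
        using False by (intro replicate_eqI) (metis letter.exhaust)+
      ultimately show ?thesis
        using qv.subspace_scale[OF S base] by metis
    qed
  qed
  then have "u \<in> S" for u
    by (induction u rule: qv_induct)
       (simp_all add: S qv.subspace_0 qv.subspace_add qv.subspace_scale)
  then show ?thesis by (auto simp: S_def)
qed

lemma bij_two_letter_basis: "bij (lin_ext two_letter_basis)"
  by (simp add: bij_def inj_two_letter_basis range_two_letter_basis)

text \<open>
  In the basis, shuffling with \<open>x\<close> is the injective index shift \<open>(m, ks) \<mapsto> (m + 1, ks)\<close>.
\<close>

lemma shuffle_x_cancel:
  assumes "basis_vec [Lx] \<squnion>\<squnion> u = 0"
  shows "u = 0"
proof -
  obtain t where t: "u = lin_ext two_letter_basis t"
    using range_two_letter_basis by blast
  define shift where "shift = lin_ext (\<lambda>(m, ks). basis_vec (Suc m, ks :: nat list))"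
  have "lin_ext two_letter_basis (shift t) = basis_vec [Lx] \<squnion>\<squnion> lin_ext two_letter_basis t"
    by (induction t rule: qv_induct) (auto simp: shift_def two_letter_basis_def shuffle_assoc)
  then have "shift t = 0"
    using assms t injD[OF inj_two_letter_basis, of "shift t" 0] by simp
  moreover have "Poly_Mapping.lookup (shift t) (Suc m, ks) = Poly_Mapping.lookup t (m, ks)" for m ks
    by (induction t rule: qv_induct) (auto simp: shift_def lookup_add lookup_single when_def split: if_splits)
  ultimately have "t = 0"
    by (intro poly_mapping_eqI) (auto simp: split_paired_all)
  then show ?thesis by (simp add: t)
qed


section \<open>The embedding onto the algebra generated by \<open>xx\<close> and \<open>W\<^sub>1\<close>\<close>

fun M_gen :: "letter \<Rightarrow> hoffman"
  where
    "M_gen Lx = xx_elem"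
  | "M_gen Ly = W_elem [1]"

abbreviation M_embed :: "hoffman \<Rightarrow> hoffman"
  where "M_embed \<equiv> zinbiel_ext M_gen"

lemma q_elem_one: "q_elem 1 = basis_vec [Lx] \<squnion>\<squnion> basis_vec [Ly]"
  by (simp add: q_elem_def shuffle_assoc)

lemma lookup_M_gen_Nil: "Poly_Mapping.lookup (M_gen a) [] = 0"
  by (cases a) (simp_all add: xx_elem_def lookup_single)

lemma left_deriv_M_gen:
  "left_deriv Lx (M_gen Lx) = basis_vec [Lx]"
  "left_deriv Lx (M_gen Ly) = basis_vec [Lx] \<squnion>\<squnion> basis_vec [Ly]"
  "left_deriv Ly (M_gen a) = 0"
  by (cases a; simp add: xx_elem_def flip: q_elem_one)+

lemma words_decompose:
  "u = qscale (Poly_Mapping.lookup u []) (basis_vec []) +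
    prepend Lx (left_deriv Lx u) + prepend Ly (left_deriv Ly u)"
proof (rule words_eqI)
  fix c show "left_deriv c u = left_deriv c (qscale (Poly_Mapping.lookup u []) (basis_vec []) +
    prepend Lx (left_deriv Lx u) + prepend Ly (left_deriv Ly u))"
    by (cases c) simp_all
qed (simp add: lookup_add)

lemma M_embed_decompose:
  "M_embed u = qscale (Poly_Mapping.lookup u []) (basis_vec []) +
    M_gen Lx \<prec> M_embed (left_deriv Lx u) + M_gen Ly \<prec> M_embed (left_deriv Ly u)"
  by (subst words_decompose[of u])
     (simp only: lin_ext_add lin_ext_scale lin_ext_basis zinbiel_ext_prepend zinbiel_word_simps)

lemma lookup_M_embed_Nil: "Poly_Mapping.lookup (M_embed u) [] = Poly_Mapping.lookup u []"
  by (subst M_embed_decompose) (simp add: lookup_add del: M_gen.simps)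

text \<open>
  The image consists of elements whose nonempty words all start with \<open>x\<close>; and both generators become
  divisible by \<open>x\<close> (for the shuffle product) once this leading \<open>x\<close> is removed.
\<close>

lemma left_deriv_M_embed:
  "left_deriv Lx (M_embed u) = basis_vec [Lx] \<squnion>\<squnion>
    (M_embed (left_deriv Lx u) + basis_vec [Ly] \<squnion>\<squnion> M_embed (left_deriv Ly u))"
  "left_deriv Ly (M_embed u) = 0"
  by (subst M_embed_decompose, simp add: left_deriv_M_gen shuffle_assoc del: M_gen.simps)+

text \<open>
  Cancelling \<open>x\<close> leaves \<open>A + y \<squnion>\<squnion> B = 0\<close> for the images \<open>A\<close>, \<open>B\<close> of the two derivatives.  The
  \<open>y\<close>-derivative annihilates the image, so applying it to this equation gives \<open>B = 0\<close>.
\<close>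

lemma M_embed_kernel_deriv:
  assumes "M_embed u = 0"
  shows "M_embed (left_deriv c u) = 0"
proof -
  let ?A = "M_embed (left_deriv Lx u)" and ?B = "M_embed (left_deriv Ly u)"
  have AB: "?A + basis_vec [Ly] \<squnion>\<squnion> ?B = 0"
    by (rule shuffle_x_cancel) (simp only: assms left_deriv_linear flip: left_deriv_M_embed(1))
  then have "left_deriv Ly (?A + basis_vec [Ly] \<squnion>\<squnion> ?B) = 0" by simp
  then have "?B = 0" by (simp add: left_deriv_M_embed)
  with AB show ?thesis by (cases c) simp_all
qed

lemma inj_M_embed: "inj M_embed"
proof (rule inj_lin_extI, rule poly_mapping_eqI)
  fix u w assume "M_embed u = 0"
  then have "Poly_Mapping.lookup u w = 0"
  proof (induction w arbitrary: u)
    case Nil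
    then show ?case using lookup_M_embed_Nil[of u] by simp
  next
    case (Cons c w)
    have "Poly_Mapping.lookup (left_deriv c u) w = 0"
      by (intro Cons.IH M_embed_kernel_deriv Cons.prems)
    then show ?case by (simp add: lookup_left_deriv)
  qed
  then show "Poly_Mapping.lookup u w = Poly_Mapping.lookup 0 w" by simp
qed

lemma zinbiel_algebra_H_pos: "zinbiel_algebra qscale H_pos (\<prec>)"
proof unfold_locales
  show "qv.subspace H_pos" unfolding H_pos_def by simp
  fix u v w :: hoffman
  assume "v \<in> H_pos"
  then show "u \<prec> v \<prec> w = u \<prec> (v \<prec> w) + u \<prec> (w \<prec> v)"
    by (simp add: half_shuffle_assoc H_pos_eq shuffle_eq_half_shuffles)
qed (simp_all add: H_pos_eq)

lemma M_embed_letter: "M_embed (basis_vec [a]) = M_gen a"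
  by (rule zinbiel_ext_letter) (rule lookup_M_gen_Nil)

text \<open>
  The image of a homomorphism is a subalgebra, and every subalgebra containing the images of the
  letters contains the right-nested products that span the image.
\<close>

lemma M_pos_eq: "M_pos = M_embed ` H_pos"
proof
  interpret L: Vector_Spaces.linear qscale qscale M_embed by (rule linear_lin_ext)
  interpret H: zinbiel_algebra qscale H_pos "(\<prec>)" by (rule zinbiel_algebra_H_pos)
  let ?C = "\<lambda>S. qv.subspace S \<and> S \<subseteq> H_pos \<and> (\<forall>u\<in>S. \<forall>v\<in>S. u \<prec> v \<in> S) \<and>
    {xx_elem, W_elem [1]} \<subseteq> S"
  have gens: "{xx_elem, W_elem [1]} = range M_gen"
  proof
    show "range M_gen \<subseteq> {xx_elem, W_elem [1]}"
    proof
      fix v assume "v \<in> range M_gen"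
      then obtain a where "v = M_gen a" by blast
      then show "v \<in> {xx_elem, W_elem [1]}" by (cases a) (simp_all del: W_elem.simps)
    qed
    show "{xx_elem, W_elem [1]} \<subseteq> range M_gen"
      using rangeI[of M_gen Lx] rangeI[of M_gen Ly] by (simp del: W_elem.simps)
  qed
  have "?C (M_embed ` H_pos)"
  proof (intro conjI ballI)
    show "qv.subspace (M_embed ` H_pos)" by (rule L.subspace_image) (rule H.subspace_carrier)
    show "M_embed ` H_pos \<subseteq> H_pos" by (auto simp: H_pos_eq lookup_M_embed_Nil)
    show "{xx_elem, W_elem [1]} \<subseteq> M_embed ` H_pos"
      unfolding gens
    proof
      fix v assume "v \<in> range M_gen"
      then obtain a where "v = M_embed (basis_vec [a])" by (metis M_embed_letter rangeE)
      then show "v \<in> M_embed ` H_pos"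
        by (auto simp: H_pos_eq lookup_single simp del: lin_ext_basis)
    qed
    fix u v assume "u \<in> M_embed ` H_pos" "v \<in> M_embed ` H_pos"
    then obtain s t where st: "u = M_embed s" "v = M_embed t" "s \<in> H_pos" "t \<in> H_pos" by blast
    then have "u \<prec> v = M_embed (s \<prec> t)"
      by (simp only: zinbiel_ext_half_shuffle lookup_M_gen_Nil)
    then show "u \<prec> v \<in> M_embed ` H_pos"
      using H.prec_closed[OF st(3,4)] by simp
  qed
  then show "M_pos \<subseteq> M_embed ` H_pos"
    unfolding M_pos_def zinbiel_generated_def by blast
  show "M_embed ` H_pos \<subseteq> M_pos"
    unfolding M_pos_def zinbiel_generated_def
  proof (rule Inter_greatest)
    fix S assume "S \<in> {S. ?C S}"
    then have S: "qv.subspace S" "\<And>u v. u \<in> S \<Longrightarrow> v \<in> S \<Longrightarrow> u \<prec> v \<in> S" "\<And>a. M_gen a \<in> S"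
      unfolding gens by auto
    have word: "zinbiel_word M_gen w \<in> S" if "w \<noteq> []" for w
      using that
    proof (induction w)
      case (Cons a w)
      then show ?case
        using S by (cases "w = []") (simp_all add: half_shuffle_Nil_right lookup_M_gen_Nil)
    qed simp
    have "M_embed u \<in> S" if "u \<in> H_pos" for u
      unfolding lin_ext_def
      using that by (intro qv.subspace_sum qv.subspace_scale S word) (auto simp: H_pos_eq in_keys_iff)
    then show "M_embed ` H_pos \<subseteq> S" by blast
  qed
qed

lemma M_alg_eq: "M_alg = range M_embed"
proof -
  have "M_embed u \<in> M_alg" for u
  proof -
    let ?c = "Poly_Mapping.lookup u []"
    have "u - qscale ?c (basis_vec []) \<in> H_pos"
      by (simp add: H_pos_eq lookup_minus)
    moreover have "M_embed u = qscale ?c (basis_vec []) + M_embed (u - qscale ?c (basis_vec []))"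
      using lin_ext_add[of "zinbiel_word M_gen" "qscale ?c (basis_vec [])" "u - qscale ?c (basis_vec [])"]
      by simp
    ultimately show ?thesis unfolding M_alg_def M_pos_eq by blast
  qed
  moreover have "qscale c (basis_vec []) + M_embed u = M_embed (qscale c (basis_vec []) + u)" for c u
    by simp
  ultimately show ?thesis unfolding M_alg_def M_pos_eq by blast
qed

lemma shuffle_pow_x_even:
  "shuffle_pow (basis_vec [Lx]) (2 * k) = qscale (2 ^ k) (shuffle_pow xx_elem k)"
proof (induction k)
  case (Suc k)
  have "basis_vec [Lx] \<squnion>\<squnion> basis_vec [Lx] = qscale 2 xx_elem"
    by (simp add: shuffle_basis xx_elem_def add_self_eq_qscale)
  moreover have "shuffle_pow (basis_vec [Lx]) (2 * Suc k) =
      basis_vec [Lx] \<squnion>\<squnion> basis_vec [Lx] \<squnion>\<squnion> shuffle_pow (basis_vec [Lx]) (2 * k)"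
    by (simp add: shuffle_assoc)
  ultimately show ?case by (simp add: Suc)
qed simp

lemma W_elem_eq_zinbiel_word: "W_elem ps = zinbiel_word (\<lambda>p. W_elem [p]) ps"
  by (induction ps) (simp_all add: prepend_eq_half_shuffle half_shuffle_assoc)

text \<open>
  Since \<open>x\<^bsup>\<squnion>\<squnion>2k\<^esup> = 2\<^sup>k (xx)\<^bsup>\<squnion>\<squnion>k\<^esup>\<close>, splitting \<open>q\<^bsub>2k+1\<^esub> = x\<^bsup>\<squnion>\<squnion>2k\<^esup> \<squnion>\<squnion> q\<^sub>1\<close> turns \<open>W\<^bsub>2k+1\<^esub>\<close> into
  \<open>2\<^sup>k W\<^sub>1 \<prec> (xx)\<^bsup>\<squnion>\<squnion>k\<^esup>\<close>.  This is where odd indices enter.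
\<close>

lemma M_embed_y_gen: "M_embed (y_gen k) = W_elem [2 * k + 1]"
proof -
  have "W_elem [2 * k + 1] = prepend Lx (shuffle_pow (basis_vec [Lx]) (2 * k) \<squnion>\<squnion> q_elem 1)"
    by (simp add: q_elem_def shuffle_assoc shuffle.left_commute)
  also have "\<dots> = qscale (2 ^ k) (M_gen Ly \<prec> shuffle_pow xx_elem k)"
    by (simp add: shuffle_pow_x_even prepend_eq_half_shuffle half_shuffle_assoc shuffle.commute)
  also have "\<dots> = M_embed (y_gen k)"
    by (simp only: y_gen_def lin_ext_scale zinbiel_ext_prepend zinbiel_ext_shuffle_pow
        lookup_M_gen_Nil M_embed_letter M_gen.simps)
  finally show ?thesis by simp
qed

lemma M_embed_two_letter_basis:
  "M_embed (two_letter_basis (m, ks)) =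
    shuffle_pow xx_elem m \<squnion>\<squnion> W_elem (map (\<lambda>k. 2 * k + 1) ks)"
proof -
  have "W_elem (map (\<lambda>k. 2 * k + 1) ks) = zinbiel_word (\<lambda>k. W_elem [2 * k + 1]) ks"
    by (subst W_elem_eq_zinbiel_word) (simp add: zinbiel_word_def foldr_map comp_def)
  then show ?thesis
    by (simp only: two_letter_basis_def prod.case zinbiel_ext_shuffle zinbiel_ext_shuffle_pow
        lookup_M_gen_Nil zinbiel_ext_zinbiel_word M_embed_y_gen M_embed_letter M_gen.simps)
qed


section \<open>Freeness\<close>

text \<open>
  The embedding identifies \<open>M_pos\<close> with the half-shuffle algebra of nonempty words in two letters, so
  the extension from letters to words transports to \<open>M_pos\<close>.  It is unique because the right-nested
  products of the generators span.
\<close>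

lemma free_zinbiel_M_pos:
  "free_zinbiel_algebra TYPE('z::ab_group_add) qscale M_pos (\<prec>) {xx_elem, W_elem [1]}"
  unfolding free_zinbiel_algebra_def
proof (intro conjI allI impI)
  note hom = zinbiel_ext_half_shuffle[OF lookup_M_gen_Nil]
  interpret H: zinbiel_algebra qscale H_pos "(\<prec>)" by (rule zinbiel_algebra_H_pos)
  interpret L: Vector_Spaces.linear qscale qscale M_embed by (rule linear_lin_ext)
  show gens: "{xx_elem, W_elem [1]} \<subseteq> M_pos"
    unfolding M_pos_def zinbiel_generated_def by blast
  have sub: "M_pos \<subseteq> H_pos"
    by (auto simp: M_pos_eq H_pos_eq lookup_M_embed_Nil)
  have closed: "u \<prec> v \<in> M_pos" if "u \<in> M_pos" "v \<in> M_pos" for u v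
    using that unfolding M_pos_def zinbiel_generated_def by blast
  show "zinbiel_algebra qscale M_pos (\<prec>)"
  proof unfold_locales
    show "qv.subspace M_pos"
      unfolding M_pos_eq by (rule L.subspace_image) (rule H.subspace_carrier)
  qed (use sub closed in \<open>auto intro: H.zinbiel\<close>)
  fix scale' :: "rat \<Rightarrow> 'z \<Rightarrow> 'z" and Z prec' h
  assume "zinbiel_algebra scale' Z prec' \<and> h \<in> {xx_elem, W_elem [1]} \<rightarrow> Z"
  then interpret Z: zinbiel_algebra scale' Z prec' by simp
  have h: "h (M_gen a) \<in> Z" for a
    using \<open>_ \<and> h \<in> _\<close> by (cases a) (simp_all del: W_elem.simps)
  let ?ext = "Z.word_ext (\<lambda>a. h (M_gen a))"
  define \<phi> where "\<phi> = restrict (\<lambda>v. ?ext (inv M_embed v)) M_pos"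
  have \<phi>: "\<phi> (M_embed u) = ?ext u" if "u \<in> H_pos" for u
    using that inj_M_embed by (simp add: \<phi>_def M_pos_eq)
  have \<phi>_hom: "zinbiel_hom_on qscale M_pos (\<prec>) scale' Z prec' \<phi>"
    unfolding zinbiel_hom_on_def
  proof (intro conjI ballI allI)
    show "\<phi> \<in> M_pos \<rightarrow> Z"
      using Z.word_ext_mem[of "\<lambda>a. h (M_gen a)", OF h] by (auto simp: M_pos_eq \<phi>)
    fix u v assume "u \<in> M_pos" "v \<in> M_pos"
    then obtain s t where st: "u = M_embed s" "v = M_embed t" "s \<in> H_pos" "t \<in> H_pos"
      unfolding M_pos_eq by blast
    have "\<phi> (u + v) = \<phi> (M_embed (s + t))" by (simp add: st)
    also have "\<dots> = \<phi> u + \<phi> v"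
      using st H.add_mem by (simp add: \<phi> del: lin_ext_add)
    finally show "\<phi> (u + v) = \<phi> u + \<phi> v" .
    have "\<phi> (u \<prec> v) = \<phi> (M_embed (s \<prec> t))" by (simp only: st hom)
    also have "\<dots> = prec' (\<phi> u) (\<phi> v)"
      using st H.prec_closed by (simp add: \<phi> Z.word_ext_half_shuffle h H_pos_eq)
    finally show "\<phi> (u \<prec> v) = prec' (\<phi> u) (\<phi> v)" .
  next
    fix c u assume "u \<in> M_pos"
    then obtain s where s: "u = M_embed s" "s \<in> H_pos"
      unfolding M_pos_eq by blast
    have "\<phi> (qscale c u) = \<phi> (M_embed (qscale c s))" by (simp add: s)
    also have "\<dots> = scale' c (\<phi> u)"
      using s H.scale_mem by (simp add: \<phi> del: lin_ext_scale)
    finally show "\<phi> (qscale c u) = scale' c (\<phi> u)" .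
  qed
  have \<phi>_gen: "\<phi> (M_gen a) = h (M_gen a)" for a
    using \<phi>[of "basis_vec [a]"] by (simp only: M_embed_letter) (simp add: H_pos_eq lookup_single)
  show "\<exists>!\<phi>. \<phi> \<in> extensional M_pos \<and> zinbiel_hom_on qscale M_pos (\<prec>) scale' Z prec' \<phi> \<and>
      (\<forall>g\<in>{xx_elem, W_elem [1]}. \<phi> g = h g)"
  proof (rule ex1I[of _ \<phi>])
    show "\<phi> \<in> extensional M_pos \<and> zinbiel_hom_on qscale M_pos (\<prec>) scale' Z prec' \<phi> \<and>
      (\<forall>g\<in>{xx_elem, W_elem [1]}. \<phi> g = h g)"
      using \<phi>_hom \<phi>_gen[of Lx] \<phi>_gen[of Ly] by (simp add: \<phi>_def del: W_elem.simps)
  next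
    fix \<psi> assume \<psi>: "\<psi> \<in> extensional M_pos \<and> zinbiel_hom_on qscale M_pos (\<prec>) scale' Z prec' \<psi> \<and>
      (\<forall>g\<in>{xx_elem, W_elem [1]}. \<psi> g = h g)"
    then have add: "\<psi> (u + v) = \<psi> u + \<psi> v" and prec: "\<psi> (u \<prec> v) = prec' (\<psi> u) (\<psi> v)"
      if "u \<in> M_pos" "v \<in> M_pos" for u v
      using that by (auto simp: zinbiel_hom_on_def)
    have scale: "\<psi> (qscale c u) = scale' c (\<psi> u)" if "u \<in> M_pos" for c u
      using \<psi> that by (auto simp: zinbiel_hom_on_def)
    have \<psi>_gen: "\<psi> (M_gen a) = h (M_gen a)" for a
      using \<psi> by (cases a) (simp_all del: W_elem.simps)
    have mem: "M_embed u \<in> M_pos" if "u \<in> H_pos" for u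
      using that by (simp add: M_pos_eq)
    have gen: "M_gen a \<in> M_pos" for a
      using gens by (cases a) (simp_all del: W_elem.simps)
    have word: "\<psi> (zinbiel_word M_gen w) = Z.word_value (\<lambda>a. h (M_gen a)) w" if "w \<noteq> []" for w
      using that
    proof (induction w rule: induct_list012)
      case (2 a)
      then show ?case by (simp add: half_shuffle_Nil_right lookup_M_gen_Nil \<psi>_gen)
    next
      case (3 a b w)
      have "zinbiel_word M_gen (b # w) \<in> M_pos"
        using mem[of "basis_vec (b # w)"] by (simp add: H_pos_eq lookup_single)
      then have "\<psi> (M_gen a \<prec> zinbiel_word M_gen (b # w)) =
          prec' (h (M_gen a)) (\<psi> (zinbiel_word M_gen (b # w)))"
        by (simp only: prec gen \<psi>_gen)
      with 3 show ?case by (simp del: M_gen.simps)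
    qed simp
    have "u \<in> H_pos \<and> \<psi> (M_embed u) = ?ext u" if "u \<in> qv.span (basis_vec ` {w. w \<noteq> []})" for u
      using that
    proof (induction rule: qv.span_induct_alt)
      case base
      have "\<psi> 0 = 0" using scale[of 0 0] mem[of 0] H.zero_mem by simp
      then show ?case by (simp add: H.zero_mem)
    next
      case (step c x y)
      then obtain w where w: "w \<noteq> []" "x = basis_vec w" by blast
      have xy: "x \<in> H_pos" "y \<in> H_pos"
        using w step by (simp_all add: H_pos_eq lookup_single)
      have "\<psi> (M_embed (qscale c x + y)) = \<psi> (M_embed (qscale c x)) + \<psi> (M_embed y)"
        by (simp only: lin_ext_add) (intro add mem H.scale_mem xy)
      also have "\<psi> (M_embed (qscale c x)) = scale' c (\<psi> (M_embed x))"
        by (simp only: lin_ext_scale) (intro scale mem xy)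
      finally have "\<psi> (M_embed (qscale c x + y)) = scale' c (\<psi> (M_embed x)) + \<psi> (M_embed y)" .
      then show ?case using w word step xy by (simp add: H.add_mem H.scale_mem)
    qed
    then have ext: "\<psi> (M_embed u) = ?ext u" if "u \<in> H_pos" for u
      using that unfolding H_pos_def by blast
    show "\<psi> = \<phi>"
    proof
      fix v show "\<psi> v = \<phi> v"
        using \<psi> ext \<phi> by (cases "v \<in> M_pos") (auto simp: M_pos_eq \<phi>_def extensional_def)
    qed
  qed
qed


section \<open>The basis and the comparison map\<close>

abbreviation W_family :: "nat \<times> nat list \<Rightarrow> hoffman"
  where "W_family \<equiv> \<lambda>(m, ps). shuffle_pow xx_elem m \<squnion>\<squnion> W_elem ps"

lemma bij_betw_map_lists:
  assumes "bij_betw f UNIV A"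
  shows "bij_betw (\<lambda>(m::'m, ks). (m, map f ks)) UNIV {(m, ps). set ps \<subseteq> A}"
proof -
  have "bij_betw (map f) (lists UNIV) (lists A)" 
    using assms by (rule bij_lists)
  then have "bij_betw (map_prod (id :: 'm \<Rightarrow> 'm) (map f)) (UNIV \<times> lists UNIV) (UNIV \<times> lists A)"
    by (intro bij_betw_map_prod) auto
  moreover have "map_prod id (map f) = (\<lambda>(m::'m, ks). (m, map f ks))"
    by auto
  moreover have "UNIV \<times> lists A = {(m::'m, ps). set ps \<subseteq> A}" by auto
  ultimately show ?thesis by (simp only: lists_UNIV UNIV_Times_UNIV)
qed

lemma is_basis_family_W_family: "is_basis_family qscale {(m, ps). \<forall>p\<in>set ps. odd p} W_family M_alg"
proof -
  let ?r = "\<lambda>(m::nat, ks). (m, map (\<lambda>k::nat. 2 * k + 1) ks)"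
  have "bij_betw (\<lambda>k. 2 * k + 1) UNIV {p::nat. odd p}"
    by (rule bij_betw_byWitness[of _ "\<lambda>p. p div 2"]) auto
  then have r: "bij_betw ?r UNIV {(m, ps). set ps \<subseteq> {p. odd p}}"
    by (rule bij_betw_map_lists)
  have "lin_ext (W_family \<circ> ?r) u = M_embed (lin_ext two_letter_basis u)" for u
    by (induction u rule: qv_induct)
      (auto simp: M_embed_two_letter_basis simp del: W_elem.simps)
  moreover have "bij_betw (\<lambda>u. M_embed (lin_ext two_letter_basis u)) UNIV M_alg"
    using bij_betw_trans[OF bij_two_letter_basis, of M_embed M_alg] inj_M_embed
    by (simp add: bij_betw_def M_alg_eq comp_def)
  ultimately have "is_basis_family qscale UNIV (W_family \<circ> ?r) M_alg"
    unfolding is_basis_family_iff_bij by presburger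
  then show ?thesis
    unfolding is_basis_family_reindex[OF r] by (simp add: subset_eq)
qed

lemma bij_comparison_map: "bij_betw comparison_map UNIV M_alg"
proof -
  let ?f = "\<lambda>k. Rep_odd_index k - 2"
  let ?r = "\<lambda>(m::nat, ks). (m, map ?f ks)"
  have "bij_betw ?f UNIV {p. odd p}"
  proof (rule bij_betw_byWitness[of _ "\<lambda>p. Abs_odd_index (p + 2)"])
    show "\<forall>k\<in>UNIV. Abs_odd_index (Rep_odd_index k - 2 + 2) = k"
    proof
      fix k
      have "2 \<le> Rep_odd_index k" using Rep_odd_index[of k] by simp
      then have "Rep_odd_index k - 2 + 2 = Rep_odd_index k" by (rule le_add_diff_inverse2)
      then show "Abs_odd_index (Rep_odd_index k - 2 + 2) = k" by (simp only: Rep_odd_index_inverse)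
    qed
    show "\<forall>p\<in>{p. odd p}. Rep_odd_index (Abs_odd_index (p + 2)) - 2 = p"
      by (auto simp: Abs_odd_index_inverse elim!: oddE)
    show "?f ` UNIV \<subseteq> {p. odd p}"
    proof (rule image_subsetI)
      fix k show "Rep_odd_index k - 2 \<in> {p. odd p}" using Rep_odd_index[of k] by simp
    qed
  qed simp
  then have r: "bij_betw ?r UNIV {(m, ps). set ps \<subseteq> {p. odd p}}"
    by (rule bij_betw_map_lists)
  have "comparison_map = lin_ext (W_family \<circ> ?r)"
    unfolding comparison_map_def by (rule arg_cong[of _ _ lin_ext]) auto
  moreover have "is_basis_family qscale UNIV (W_family \<circ> ?r) M_alg"
    unfolding is_basis_family_reindex[OF r] 
    using is_basis_family_W_family by (simp add: subset_eq)
  ultimately show ?thesis by (simp add: is_basis_family_iff_bij)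
qed

text \<open>
  For a fixed power of \<open>f\<^sub>2\<close> the comparison map is, up to the factor \<open>(xx)\<^bsup>\<squnion>\<squnion>m\<^esup>\<close>, an extension from
  letters to words, and hence compatible with shuffles.
\<close>

lemma comparison_map_monom:
  "comparison_map (monom 1 m \<otimes> u) =
    shuffle_pow xx_elem m \<squnion>\<squnion> zinbiel_ext (\<lambda>k. W_elem [Rep_odd_index k - 2]) u"
proof (induction u rule: qv_induct)
  case (basis ks)
  have "W_elem (map (\<lambda>k. Rep_odd_index k - 2) ks) = zinbiel_word (\<lambda>k. W_elem [Rep_odd_index k - 2]) ks"
    by (subst W_elem_eq_zinbiel_word) (simp add: zinbiel_word_def foldr_map comp_def)
  then show ?case by (simp add: comparison_map_pure del: W_elem.simps)
qed (simp_all add: pure_tensor_bilinear comparison_map_def)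

lemma comparison_map_mult: "comparison_map (tensor_mult s t) = comparison_map s \<squnion>\<squnion> comparison_map t"
proof (induction s t rule: bilinear_induct)
  case (basis i j)
  obtain m u n v where ij: "i = (m, u)" "j = (n, v)" by (cases i; cases j)
  let ?W = "zinbiel_ext (\<lambda>k. W_elem [Rep_odd_index k - 2])"
  have W: "?W (u \<squnion>\<squnion> v) = ?W u \<squnion>\<squnion> ?W v" for u v
    by (rule zinbiel_ext_shuffle) simp
  have "comparison_map (tensor_mult (monom 1 m \<otimes> basis_vec u) (monom 1 n \<otimes> basis_vec v)) =
      comparison_map (monom 1 (m + n) \<otimes> (basis_vec u \<squnion>\<squnion> basis_vec v))"
    by (simp add: tensor_mult_pure mult_monom)
  also have "\<dots> = (shuffle_pow xx_elem m \<squnion>\<squnion> ?W (basis_vec u)) \<squnion>\<squnion> (shuffle_pow xx_elem n \<squnion>\<squnion> ?W (basis_vec v))"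
    by (simp only: comparison_map_monom W shuffle_pow_add shuffle.assoc shuffle.left_commute)
  also have "\<dots> = comparison_map (monom 1 m \<otimes> basis_vec u) \<squnion>\<squnion> comparison_map (monom 1 n \<otimes> basis_vec v)"
    by (simp only: comparison_map_monom)
  finally show ?case by (simp only: pure_tensor_monom ij)
qed (simp_all add: comparison_map_def tensor_mult_add_left tensor_mult_add_right
      tensor_mult_scale_left tensor_mult_scale_right tensor_mult_zero_left tensor_mult_zero_right)

theorem proposition4p1:
  "(xx_elem \<noteq> W_elem [1] \<and>
      free_zinbiel_algebra TYPE('z::ab_group_add) qscale M_pos (\<prec>) {xx_elem, W_elem [1]}) \<and>
   is_basis_family qscale {(m, ps). \<forall>p\<in>set ps. odd p}
      (\<lambda>(m, ps). shuffle_pow xx_elem m \<squnion>\<squnion> W_elem ps) M_alg \<and>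
   tensor_algebra_iso_onto M_alg comparison_map"
proof (intro conjI)
  show "xx_elem \<noteq> W_elem [1]"
  proof
    assume "xx_elem = W_elem [1]"
    then have "M_embed (basis_vec [Lx]) = M_embed (basis_vec [Ly])"
      by (simp only: M_embed_letter M_gen.simps)
    then have "basis_vec [Lx] = (basis_vec [Ly] :: hoffman)"
      using inj_M_embed by (simp add: inj_eq del: lin_ext_basis)
    then show False
      by (metis letter.distinct(1) list.inject lookup_single_eq lookup_single_not_eq zero_neq_one)
  qed
  show "free_zinbiel_algebra TYPE('z::ab_group_add) qscale M_pos (\<prec>) {xx_elem, W_elem [1]}"
    by (rule free_zinbiel_M_pos)
  show "is_basis_family qscale {(m, ps). \<forall>p\<in>set ps. odd p} W_family M_alg"
    by (rule is_basis_family_W_family)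
  have "comparison_map tensor_one = basis_vec []"
    using comparison_map_monom[of 0 "basis_vec []"] by (simp add: tensor_one_def)
  moreover have "Vector_Spaces.linear qscale qscale comparison_map"
    unfolding comparison_map_def by (rule linear_lin_ext)
  ultimately show "tensor_algebra_iso_onto M_alg comparison_map"
    by (simp add: tensor_algebra_iso_onto_def comparison_map_mult bij_comparison_map)
qed

end
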